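(* Let $K$ be a compact convex subset of a locally convex Hausdorff space over $\mathbb{R}$. Then $K$ is a Choquet simplex if and only if any pair $(f_k)_{k=1}^2$ and $(g_j)_{j=1}^2$ of $2$-outcome measurements on $A(K)$ are compatible.
   Context: All linear spaces are over $\mathbb{R}$. For a compact convex subset $K$ of a locally convex Hausdorff space, $A(K)$ denotes the Banach space of continuous real affine functionals on $K$ with the supremum norm $\|f\| = \sup_{x\in K}|f(x)|$, ordered pointwise with positive cone $A(K)_+ = \{f \in A(K) : f(x)\ge 0 \ \forall x\in K\}$; $1_K$ is the constant functional equal to $1$. $K$ is called a Choquet simplex if the Banach dual $A(K)^*$, ordered by the dual positive cone $A(K)^*_+ = \{\psi\in A(K)^* : \psi(f)\ge 0 \ \forall f\in A(K)_+\}$, is a lattice. An $m$-outcome measurement on $A(K)$ is a finite sequence $(f_k)_{k=1}^m\in A(K)^m$ with $f_k\ge 0$ for $1\le k\le m$ and $\sum_{k=1}^m f_k = 1_K$. Two measurements $(f_k)_{k=1}^m$ and $(g_j)_{j=1}^n$ on $A(K)$ are called compatible if there exists a family $(h_{k,j})_{1\le k\le m,\,1\le j\le n}$ in $A(K)$ such that $h_{k,j}\ge 0$, $f_k = \sum_{j'=1}^n h_{k,j'}$ and $g_j = \sum_{k'=1}^m h_{k',j}$ for all $1\le k\le m$, $1\le j\le n$. *)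

theory Defs
  imports "HOL-Analysis.Analysis" "HOL-Algebra.Lattice"
begin

class topological_real_vector = real_vector + topological_ab_group_add +
  assumes tendsto_scaleR_Pair:
    "LIM p (nhds c \<times>\<^sub>F nhds a). fst p *\<^sub>R snd p :> nhds (c *\<^sub>R a)"

(* The third conjunct spells out "convex V": a class specification cannot mention a constant
   whose type is already constrained to real_vector. *)
class locally_convex_t2_space = topological_real_vector + t2_space +
  assumes convex_nhds_basis:
    "open U \<Longrightarrow> 0 \<in> U \<Longrightarrow>
      \<exists>V. open V \<and> 0 \<in> V \<and>
        (\<forall>x\<in>V. \<forall>y\<in>V. \<forall>u\<ge>0. \<forall>v\<ge>0. u + v = 1 \<longrightarrow> u *\<^sub>R x + v *\<^sub>R y \<in> V) \<and>
        V \<subseteq> U"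

instance real_normed_vector \<subseteq> topological_real_vector
proof
  fix c :: real and a :: 'a
  show "LIM p (nhds c \<times>\<^sub>F nhds a). fst p *\<^sub>R snd p :> nhds (c *\<^sub>R a)"
    by (intro tendsto_scaleR filterlim_fst filterlim_snd)
qed

instance real_normed_vector \<subseteq> locally_convex_t2_space
proof
  fix U :: "'a set"
  assume "open U" "0 \<in> U"
  then obtain e where "e > 0" "ball 0 e \<subseteq> U"
    using open_contains_ball by blast
  then have "open (ball (0::'a) e) \<and> (0::'a) \<in> ball 0 e \<and> convex (ball (0::'a) e) \<and> ball 0 e \<subseteq> U"
    by simp
  then show "\<exists>V. open V \<and> 0 \<in> V \<and>
      (\<forall>x\<in>V. \<forall>y\<in>V. \<forall>u\<ge>0. \<forall>v\<ge>0. u + v = 1 \<longrightarrow> u *\<^sub>R x + v *\<^sub>R y \<in> V) \<and> V \<subseteq> U"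
    unfolding convex_def by blast
qed

(* An element of A(K) is represented by its extension by zero to the whole space. Hence
   equality of representatives is equality on K, and A(K) is closed under the
   pointwise operations. *)
definition affine_functionals :: "'a::{real_vector,topological_space} set \<Rightarrow> ('a \<Rightarrow> real) set" where
  "affine_functionals K =
    {f. continuous_on K f \<and>
        (\<forall>x\<in>K. \<forall>y\<in>K. \<forall>t\<in>{0..1}. f ((1 - t) *\<^sub>R x + t *\<^sub>R y) = (1 - t) * f x + t * f y) \<and>
        (\<forall>x. x \<notin> K \<longrightarrow> f x = 0)}"

definition affine_functionals_pos :: "'a::{real_vector,topological_space} set \<Rightarrow> ('a \<Rightarrow> real) set" where
  "affine_functionals_pos K = {f \<in> affine_functionals K. \<forall>x\<in>K. 0 \<le> f x}"

definition sup_norm_on :: "'a set \<Rightarrow> ('a \<Rightarrow> real) \<Rightarrow> real" where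
  "sup_norm_on K f = (SUP x\<in>K. \<bar>f x\<bar>)"

(* The Banach dual of A(K), its elements again extended by zero outside A(K). *)
definition dual_functionals ::
  "'a::{real_vector,topological_space} set \<Rightarrow> (('a \<Rightarrow> real) \<Rightarrow> real) set" where
  "dual_functionals K =
    {\<psi>. (\<forall>f\<in>affine_functionals K. \<forall>g\<in>affine_functionals K. \<psi> (\<lambda>x. f x + g x) = \<psi> f + \<psi> g) \<and>
        (\<forall>c. \<forall>f\<in>affine_functionals K. \<psi> (\<lambda>x. c * f x) = c * \<psi> f) \<and>
        (\<exists>C. \<forall>f\<in>affine_functionals K. \<bar>\<psi> f\<bar> \<le> C * sup_norm_on K f) \<and>
        (\<forall>f. f \<notin> affine_functionals K \<longrightarrow> \<psi> f = 0)}"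

definition dual_functionals_pos ::
  "'a::{real_vector,topological_space} set \<Rightarrow> (('a \<Rightarrow> real) \<Rightarrow> real) set" where
  "dual_functionals_pos K =
    {\<psi> \<in> dual_functionals K. \<forall>f\<in>affine_functionals_pos K. 0 \<le> \<psi> f}"

definition dual_order ::
  "'a::{real_vector,topological_space} set \<Rightarrow> (('a \<Rightarrow> real) \<Rightarrow> real) gorder" where
  "dual_order K =
    \<lparr>carrier = dual_functionals K, eq = (=),
     le = (\<lambda>\<phi> \<psi>. (\<lambda>f. \<psi> f - \<phi> f) \<in> dual_functionals_pos K)\<rparr>"

definition choquet_simplex :: "'a::{real_vector,topological_space} set \<Rightarrow> bool" where
  "choquet_simplex K \<longleftrightarrow> Lattice.lattice (dual_order K)"

(* Finite sequences are indexed by 1..m; values at other indices are irrelevant. *)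
definition measurement ::
  "'a::{real_vector,topological_space} set \<Rightarrow> nat \<Rightarrow> (nat \<Rightarrow> 'a \<Rightarrow> real) \<Rightarrow> bool" where
  "measurement K m f \<longleftrightarrow>
    (\<forall>k\<in>{1..m}. f k \<in> affine_functionals_pos K) \<and>
    (\<lambda>x. \<Sum>k=1..m. f k x) = indicator K"

definition compatible ::
  "'a::{real_vector,topological_space} set \<Rightarrow> nat \<Rightarrow> (nat \<Rightarrow> 'a \<Rightarrow> real) \<Rightarrow>
    nat \<Rightarrow> (nat \<Rightarrow> 'a \<Rightarrow> real) \<Rightarrow> bool" where
  "compatible K m f n g \<longleftrightarrow>
    (\<exists>h :: nat \<Rightarrow> nat \<Rightarrow> 'a \<Rightarrow> real. \<forall>k\<in>{1..m}. \<forall>j\<in>{1..n}.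
      h k j \<in> affine_functionals_pos K \<and>
      f k = (\<lambda>x. \<Sum>j'=1..n. h k j' x) \<and>
      g j = (\<lambda>x. \<Sum>k'=1..m. h k' j x))"

end

theory Submission
  imports Defs "HOL-Library.Function_Algebras"
begin

text \<open>
  For two-outcome measurements \<open>(f, 1 - f)\<close> and \<open>(g, 1 - g)\<close>, compatibility means that some
  \<open>h \<in> A(K)\<close> satisfies \<open>0, f + g - 1 \<le> h \<le> f, g\<close>.

  If such an \<open>h\<close> always exists, then for \<open>\<psi>\<close> in the dual the function \<open>p f = sup {\<psi> g | 0 \<le> g \<le> f}\<close>
  is superadditive on the positive cone and satisfies \<open>p f + p (1 - f) = p 1\<close> for \<open>0 \<le> f \<le> 1\<close>. The
  second property makes the concave function \<open>p\<close> also convex, hence additive, and its linear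
  extension is the positive part of \<open>\<psi>\<close>.

  Conversely, suppose that the dual is a lattice and that \<open>u1, u2 \<le> v1, v2\<close>. If no \<open>h\<close> interpolates
  up to \<open>\<epsilon>\<close>, separation in \<open>A(K)\<^sup>4\<close> yields positive functionals with
  \<open>\<phi>0 + \<phi>1 = \<phi>2 + \<phi>3\<close> and \<open>\<phi>2 v1 + \<phi>3 v2 < \<phi>0 u1 + \<phi>1 u2\<close>, which the Riesz decomposition property
  of the dual rules out. Completeness of \<open>A(K)\<close> turns approximate interpolation into exact
  interpolation.
\<close>

section \<open>Separating a point from a cone with an order unit\<close>

text \<open>An algebraic form of Hahn-Banach separation in which the order unit \<open>e\<close>
  takes the place of an interior point of \<open>Q\<close>. The normalisation
  \<open>\<phi> e = 1\<close> keeps the functional from being zero and later turns a weak inequality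
  into a strict one.\<close>

lemma cone_separation:
  fixes W Q :: "'v::real_vector set"
  assumes W: "subspace W" and QW: "Q \<subseteq> W" and Q: "convex_cone Q"
    and e: "e \<in> Q" and order_unit: "\<forall>v\<in>W. \<exists>t. t *\<^sub>R e + v \<in> Q"
    and z: "z \<in> W" "z \<notin> Q"
  shows "\<exists>\<phi>. (\<forall>v\<in>W. \<forall>w\<in>W. \<phi> (v + w) = \<phi> v + \<phi> w) \<and> (\<forall>c. \<forall>v\<in>W. \<phi> (c *\<^sub>R v) = c * \<phi> v) \<and>
    (\<forall>q\<in>Q. 0 \<le> \<phi> q) \<and> \<phi> z \<le> 0 \<and> \<phi> e = (1::real)"
proof -
  note unit = bspec[OF order_unit]
  \<comment> \<open>A maximal cone avoiding \<open>z\<close> contains \<open>v\<close> or \<open>- v\<close> for every \<open>v\<close>, so it determines \<open>\<phi>\<close>.\<close>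
  define \<C> where "\<C> = {P. Q \<subseteq> P \<and> P \<subseteq> W \<and> convex_cone P \<and> z \<notin> P}"
  have "\<exists>M\<in>\<C>. \<forall>X\<in>\<C>. M \<subseteq> X \<longrightarrow> X = M"
  proof (rule subset_Zorn_nonempty)
    show "\<C> \<noteq> {}" using QW Q z by (auto simp: \<C>_def)
    fix C assume ne: "C \<noteq> {}" and ch: "subset.chain \<C> C"
    then have sub: "C \<subseteq> \<C>" and lin: "\<And>X Y. X \<in> C \<Longrightarrow> Y \<in> C \<Longrightarrow> X \<subseteq> Y \<or> Y \<subseteq> X"
      by (auto simp: subset.chain_def)
    have cone: "convex_cone X" if "X \<in> C" for X using that sub by (auto simp: \<C>_def)
    have "convex_cone (\<Union>C)"
      unfolding convex_cone_iff
    proof (intro conjI ballI allI impI)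
      show "0 \<in> \<Union>C" using ne cone convex_cone_contains_0 by blast
      show "x + y \<in> \<Union>C" if "x \<in> \<Union>C" "y \<in> \<Union>C" for x y
      proof -
        from that obtain X Y where XY: "x \<in> X" "X \<in> C" "y \<in> Y" "Y \<in> C" by blast
        then obtain Z where "Z \<in> C" "x \<in> Z" "y \<in> Z" using lin[of X Y] by blast
        then show ?thesis using convex_cone_add[OF cone] by blast
      qed
      show "c *\<^sub>R x \<in> \<Union>C" if "x \<in> \<Union>C" "0 \<le> c" for x c
        using that convex_cone_scaleR[OF cone] by blast
    qed
    then show "\<Union>C \<in> \<C>" using sub ne by (auto simp: \<C>_def)
  qed
  then obtain P where P: "P \<in> \<C>" and max: "\<And>X. X \<in> \<C> \<Longrightarrow> P \<subseteq> X \<Longrightarrow> X = P"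
    by blast
  then have QP: "Q \<subseteq> P" and PW: "P \<subseteq> W" and cone: "convex_cone P" and zP: "z \<notin> P"
    by (auto simp: \<C>_def)
  note add = convex_cone_add[OF cone] and scale = convex_cone_scaleR[OF cone]
  have zero: "0 \<in> P" using cone by (rule convex_cone_contains_0)
  \<comment> \<open>By maximality, adjoining any \<open>v\<close> outside \<open>P\<close> produces
    \<open>z\<close>; the coefficient of \<open>v\<close> cannot be zero because
    \<open>z \<notin> P\<close>.\<close>
  have absorb: "\<exists>p\<in>P. \<exists>s>0. z = p + s *\<^sub>R v" if v: "v \<in> W" "v \<notin> P" for v
  proof -
    define P' where "P' = {p + s *\<^sub>R v |p s. p \<in> P \<and> 0 \<le> s}"
    have P'I: "p + s *\<^sub>R v \<in> P'" if "p \<in> P" "0 \<le> s" for p s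
      using that by (auto simp: P'_def)
    have "P \<subseteq> P'" using P'I[of _ 0] by auto
    moreover have "v \<in> P'" using P'I[OF zero, of 1] by simp
    ultimately have "P' \<notin> \<C>" using max v by auto
    moreover have "P' \<subseteq> W"
      using PW v W by (auto simp: P'_def intro!: subspace_add subspace_scale)
    moreover have "convex_cone P'"
      unfolding convex_cone_iff
    proof (intro conjI ballI allI impI)
      show "0 \<in> P'" using zero \<open>P \<subseteq> P'\<close> by auto
      show "x + y \<in> P'" if "x \<in> P'" "y \<in> P'" for x y
      proof -
        from that obtain p s q t
          where *: "p \<in> P" "q \<in> P" "0 \<le> s" "0 \<le> t" "x = p + s *\<^sub>R v" "y = q + t *\<^sub>R v"
          by (auto simp: P'_def)
        have "(p + q) + (s + t) *\<^sub>R v \<in> P'" using * by (intro P'I add) auto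
        then show ?thesis using * by (simp add: algebra_simps)
      qed
      show "c *\<^sub>R x \<in> P'" if "x \<in> P'" "0 \<le> c" for x c
      proof -
        from that obtain p s where *: "p \<in> P" "0 \<le> s" "x = p + s *\<^sub>R v"
          by (auto simp: P'_def)
        have "c *\<^sub>R p + (c * s) *\<^sub>R v \<in> P'" using * that by (intro P'I scale) auto
        then show ?thesis using * by (simp add: algebra_simps)
      qed
    qed
    ultimately have "z \<in> P'" using QP \<open>P \<subseteq> P'\<close> by (auto simp: \<C>_def)
    then obtain p s where "p \<in> P" "0 \<le> s" "z = p + s *\<^sub>R v" by (auto simp: P'_def)
    moreover have "s \<noteq> 0" using calculation zP by auto
    ultimately show ?thesis by (intro bexI[of _ p] exI[of _ s]) auto
  qed
  have total: "v \<in> P \<or> - v \<in> P" if v: "v \<in> W" for v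
  proof (rule ccontr)
    assume "\<not> (v \<in> P \<or> - v \<in> P)"
    moreover have "- v \<in> W" using W v by (rule subspace_neg)
    ultimately obtain p s q t where *: "p \<in> P" "0 < s" "z = p + s *\<^sub>R v"
      "q \<in> P" "0 < t" "z = q + t *\<^sub>R (- v)"
      using absorb[OF v] absorb[of "- v"] by blast
    \<comment> \<open>Weighting the two representations of \<open>z\<close> by \<open>t\<close> and
      \<open>s\<close> cancels \<open>v\<close> and puts a positive multiple of \<open>z\<close>
      into \<open>P\<close>.\<close>
    have "(s + t) *\<^sub>R z = t *\<^sub>R z + s *\<^sub>R z" by (simp add: algebra_simps)
    also have "\<dots> = t *\<^sub>R (p + s *\<^sub>R v) + s *\<^sub>R (q + t *\<^sub>R (- v))"
      using *(3,6) by simp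
    also have "\<dots> = t *\<^sub>R p + s *\<^sub>R q" by (simp add: algebra_simps)
    also have "\<dots> \<in> P" using * by (intro add scale) auto
    finally have "(s + t) *\<^sub>R z \<in> P" .
    from scale[OF _ this, of "1 / (s + t)"] show False using zP *(2,5) by simp
  qed
  have eP: "e \<in> P" using e QP by auto
  then have eW: "e \<in> W" using PW by auto
  \<comment> \<open>Since some \<open>t e + z\<close> lies in \<open>P\<close>, a negative multiple
    of \<open>e\<close> in \<open>P\<close> could be rescaled to cancel \<open>t e\<close>, leaving
    \<open>z \<in> P\<close>.\<close>
  have coeff: "0 \<le> c" if "c *\<^sub>R e \<in> P" for c
  proof (rule ccontr)
    assume c: "\<not> 0 \<le> c"
    obtain t where t: "t *\<^sub>R e + z \<in> P" using unit z QP by blast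
    have "(\<bar>t\<bar> - t) *\<^sub>R e \<in> P" using eP by (intro scale) auto
    moreover have "(- \<bar>t\<bar>) *\<^sub>R e \<in> P"
      using scale[OF _ that, of "\<bar>t\<bar> / (- c)"] c by (simp add: divide_nonneg_neg divide_nonneg_nonpos)
    ultimately have "(t *\<^sub>R e + z) + ((\<bar>t\<bar> - t) *\<^sub>R e + (- \<bar>t\<bar>) *\<^sub>R e) \<in> P"
      by (rule add[OF t add])
    then show False using zP by (simp add: algebra_simps)
  qed
  have dense: "c *\<^sub>R e \<in> P" if "0 \<le> c" for c using that scale eP by auto
  \<comment> \<open>Comparison with multiples of \<open>e\<close> gives a Dedekind cut:
    \<open>above\<close> and \<open>below\<close> show that \<open>\<phi> v\<close> separates the
    upper bounds of \<open>v\<close> from the lower ones.\<close>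
  define \<phi> where "\<phi> v = Inf {t. t *\<^sub>R e - v \<in> P}" for v
  have bdd: "bdd_below {t. t *\<^sub>R e - v \<in> P}" if v: "v \<in> W" for v
  proof -
    obtain t where t: "t *\<^sub>R e + v \<in> P" using unit v QP by blast
    have "- t \<le> s" if "s *\<^sub>R e - v \<in> P" for s
      using add[OF that t] coeff[of "s + t"] by (simp add: algebra_simps)
    then show ?thesis by (intro bdd_belowI[of _ "- t"]) auto
  qed
  have above: "t *\<^sub>R e - v \<in> P" if v: "v \<in> W" and t: "\<phi> v < t" for v t
  proof -
    obtain r where "r *\<^sub>R e + (- v) \<in> P" using unit[OF subspace_neg[OF W v]] QP by blast
    then have "{t. t *\<^sub>R e - v \<in> P} \<noteq> {}" by auto
    then obtain s where s: "s *\<^sub>R e - v \<in> P" "s < t"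
      using cInf_lessD[of "{t. t *\<^sub>R e - v \<in> P}" t] t by (auto simp: \<phi>_def)
    then have "(s *\<^sub>R e - v) + (t - s) *\<^sub>R e \<in> P" using add[OF s(1) dense[of "t - s"]] by simp
    then show ?thesis by (simp add: algebra_simps)
  qed
  have below: "v - t *\<^sub>R e \<in> P" if v: "v \<in> W" and t: "t < \<phi> v" for v t
  proof -
    have "t *\<^sub>R e - v \<notin> P" using t cInf_lower[OF _ bdd[OF v], of t] by (auto simp: \<phi>_def)
    moreover have "t *\<^sub>R e - v \<in> W" using W v eW by (intro subspace_diff subspace_scale)
    ultimately show ?thesis using total[of "t *\<^sub>R e - v"] by simp
  qed
  \<comment> \<open>At most one number has both one-sided properties, since two of them would leave
    room for \<open>s < t\<close> with \<open>(s - t) e \<in> P\<close>, against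
    \<open>coeff\<close>. Linearity of \<open>\<phi>\<close> is derived from this
    uniqueness.\<close>
  have eqI: "\<phi> v = r" if v: "v \<in> W" and up: "\<And>t. r < t \<Longrightarrow> t *\<^sub>R e - v \<in> P"
    and lo: "\<And>t. t < r \<Longrightarrow> v - t *\<^sub>R e \<in> P" for v r
  proof (rule ccontr)
    have no: "\<not> (\<exists>s t. s < t \<and> s *\<^sub>R e - v \<in> P \<and> v - t *\<^sub>R e \<in> P)"
    proof safe
      fix s t assume "s < t" and "s *\<^sub>R e - v \<in> P" "v - t *\<^sub>R e \<in> P"
      from add[OF this(2,3)] have "(s - t) *\<^sub>R e \<in> P" by (simp add: algebra_simps)
      with coeff[of "s - t"] \<open>s < t\<close> show False by simp
    qed
    assume "\<phi> v \<noteq> r"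
    then consider "\<phi> v < r" | "r < \<phi> v" by linarith
    then show False
    proof cases
      case 1
      obtain s where s: "\<phi> v < s" "s < r" using dense_order_class.dense 1 by blast
      obtain t where "s < t" "t < r" using dense_order_class.dense s by blast
      then show False using no above[OF v s(1)] lo by blast
    next
      case 2
      obtain s where s: "r < s" "s < \<phi> v" using dense_order_class.dense 2 by blast
      obtain t where "s < t" "t < \<phi> v" using dense_order_class.dense s by blast
      then show False using no below[OF v] up s by blast
    qed
  qed
  have \<phi>_add: "\<phi> (v + w) = \<phi> v + \<phi> w" if v: "v \<in> W" and w: "w \<in> W" for v w
  proof (rule eqI)
    show "v + w \<in> W" using W v w by (rule subspace_add)
  next
    fix t assume t: "\<phi> v + \<phi> w < t"
    \<comment> \<open>The excess of \<open>t\<close> over \<open>\<phi> v + \<phi> w\<close> is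
      shared equally, so that \<open>\<phi> v < a\<close> and
      \<open>\<phi> w < t - a\<close>.\<close>
    define a where "a = (\<phi> v + t - \<phi> w) / 2"
    have "a *\<^sub>R e - v + ((t - a) *\<^sub>R e - w) \<in> P"
      using t by (intro add above v w) (auto simp: a_def field_simps)
    then show "t *\<^sub>R e - (v + w) \<in> P" by (simp add: algebra_simps)
  next
    fix t assume t: "t < \<phi> v + \<phi> w"
    define a where "a = (\<phi> v + t - \<phi> w) / 2"
    have "v - a *\<^sub>R e + (w - (t - a) *\<^sub>R e) \<in> P"
      using t by (intro add below v w) (auto simp: a_def field_simps)
    then show "v + w - t *\<^sub>R e \<in> P" by (simp add: algebra_simps)
  qed
  have \<phi>_neg: "\<phi> (- v) = - \<phi> v" if v: "v \<in> W" for v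
  proof (rule eqI)
    show "- v \<in> W" using W v by (rule subspace_neg)
    show "t *\<^sub>R e - (- v) \<in> P" if "- \<phi> v < t" for t
      using below[OF v, of "- t"] that by (simp add: algebra_simps)
    show "- v - t *\<^sub>R e \<in> P" if "t < - \<phi> v" for t
      using above[OF v, of "- t"] that by (simp add: minus_diff_commute)
  qed
  have \<phi>_pos_scale: "\<phi> (c *\<^sub>R v) = c * \<phi> v" if v: "v \<in> W" and c: "0 < c" for c v
  proof (rule eqI)
    show "c *\<^sub>R v \<in> W" using W v by (rule subspace_scale)
    show "t *\<^sub>R e - c *\<^sub>R v \<in> P" if "c * \<phi> v < t" for t
      using scale[OF _ above[OF v, of "t / c"], of c] that c
      by (simp add: algebra_simps pos_less_divide_eq)
    show "c *\<^sub>R v - t *\<^sub>R e \<in> P" if "t < c * \<phi> v" for t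
      using scale[OF _ below[OF v, of "t / c"], of c] that c
      by (simp add: algebra_simps pos_divide_less_eq)
  qed
  have \<phi>_scale: "\<phi> (c *\<^sub>R v) = c * \<phi> v" if v: "v \<in> W" for c v
  proof (cases c "0::real" rule: linorder_cases)
    case less
    then show ?thesis using \<phi>_pos_scale[OF subspace_neg[OF W v], of "- c"] \<phi>_neg[OF v] by simp
  next
    case equal
    then show ?thesis using \<phi>_neg[of 0] subspace_0[OF W] by simp
  qed (use \<phi>_pos_scale v in auto)
  have pos: "0 \<le> \<phi> q" if q: "q \<in> P" for q
  proof (rule ccontr)
    assume "\<not> 0 \<le> \<phi> q"
    then obtain t where t: "\<phi> q < t" "t < 0" using dense_order_class.dense[of "\<phi> q" 0] by force
    then have "t *\<^sub>R e \<in> P" using add[OF above[OF _ t(1)] q] q PW by auto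
    then show False using coeff[of t] t by simp
  qed
  have "\<phi> z \<le> 0" using pos[of "- z"] \<phi>_neg[OF z(1)] total[OF z(1)] zP by auto
  moreover have "\<phi> e = 1"
  proof (rule eqI[OF eW])
    show "t *\<^sub>R e - e \<in> P" if "1 < t" for t
      using dense[of "t - 1"] that by (simp add: algebra_simps)
    show "e - t *\<^sub>R e \<in> P" if "t < 1" for t
      using dense[of "1 - t"] that by (simp add: algebra_simps)
  qed
  ultimately show ?thesis using \<phi>_add \<phi>_scale pos QP by (intro exI[of _ \<phi>]) auto
qed

text \<open>Pointwise operations make the fourfold product of \<open>A\<close> a subspace of a
  \<open>real_vector\<close> type, as required for applying \<open>cone_separation\<close>.\<close>

instantiation "fun" :: (type, real_vector) real_vector
begin

definition scaleR_fun :: "real \<Rightarrow> ('a \<Rightarrow> 'b) \<Rightarrow> 'a \<Rightarrow> 'b"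
  where "scaleR_fun c f = (\<lambda>x. c *\<^sub>R f x)"

instance
  by standard (simp_all add: scaleR_fun_def fun_eq_iff algebra_simps)

end

section \<open>Affine functionals and their dual\<close>

locale compact_convex =
  fixes K :: "'a::{real_vector,topological_space} set"
  assumes compact_K: "compact K" and convex_K: "convex K"
begin

abbreviation "A \<equiv> affine_functionals K"
abbreviation "A_pos \<equiv> affine_functionals_pos K"
abbreviation "A_dual \<equiv> dual_functionals K"

section \<open>Linear structure of A(K)\<close>

lemma affineI:
  assumes "continuous_on K f"
    and "\<And>x y t. x \<in> K \<Longrightarrow> y \<in> K \<Longrightarrow> t \<in> {0..1} \<Longrightarrow>
      f ((1 - t) *\<^sub>R x + t *\<^sub>R y) = (1 - t) * f x + t * f y"
    and "\<And>x. x \<notin> K \<Longrightarrow> f x = 0"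
  shows "f \<in> A"
  using assms by (auto simp: affine_functionals_def)

lemma affineD:
  assumes "f \<in> A"
  shows "continuous_on K f"
    and "x \<in> K \<Longrightarrow> y \<in> K \<Longrightarrow> t \<in> {0..1} \<Longrightarrow>
      f ((1 - t) *\<^sub>R x + t *\<^sub>R y) = (1 - t) * f x + t * f y"
    and "x \<notin> K \<Longrightarrow> f x = 0"
  using assms by (auto simp: affine_functionals_def)

lemma affine_add:
  assumes "f \<in> A" "g \<in> A"
  shows "(\<lambda>x. f x + g x) \<in> A"
proof (rule affineI)
  show "continuous_on K (\<lambda>x. f x + g x)" using assms by (intro continuous_on_add affineD)
qed (simp_all add: affineD[OF assms(1)] affineD[OF assms(2)] ring_distribs)

lemma affine_scale:
  assumes "f \<in> A"
  shows "(\<lambda>x. c * f x) \<in> A"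
proof (rule affineI)
  show "continuous_on K (\<lambda>x. c * f x)" using assms by (intro continuous_on_mult_left affineD)
qed (simp_all add: affineD[OF assms] ring_distribs)

lemma affine_diff: "f \<in> A \<Longrightarrow> g \<in> A \<Longrightarrow> (\<lambda>x. f x - g x) \<in> A"
  using affine_add[of f "\<lambda>x. - 1 * g x"] affine_scale[of g "- 1"] by simp

lemma affine_uminus: "f \<in> A \<Longrightarrow> (\<lambda>x. - f x) \<in> A"
  using affine_scale[of f "- 1"] by simp

lemma affine_zero: "(\<lambda>x. 0) \<in> A"
  by (auto simp: affine_functionals_def)

lemma affine_one: "indicator K \<in> A"
proof -
  have "continuous_on K (indicator K :: 'a \<Rightarrow> real)"
    by (rule continuous_on_eq[of _ "\<lambda>x. 1"]) auto
  moreover have "(1 - t) *\<^sub>R x + t *\<^sub>R y \<in> K" if "x \<in> K" "y \<in> K" "t \<in> {0..1}" for x y t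
    using that convex_K by (auto simp: convex_alt)
  ultimately show ?thesis by (auto simp: affine_functionals_def)
qed

section \<open>The positive cone and the supremum norm\<close>

lemma posD: "f \<in> A_pos \<Longrightarrow> f \<in> A" "f \<in> A_pos \<Longrightarrow> x \<in> K \<Longrightarrow> 0 \<le> f x"
  by (auto simp: affine_functionals_pos_def)

lemma posI: "f \<in> A \<Longrightarrow> (\<And>x. x \<in> K \<Longrightarrow> 0 \<le> f x) \<Longrightarrow> f \<in> A_pos"
  by (auto simp: affine_functionals_pos_def)

lemma pos_one: "indicator K \<in> A_pos"
  by (intro posI affine_one) simp

lemma pos_zero: "(\<lambda>x. 0) \<in> A_pos"
  by (intro posI affine_zero) simp

lemma pos_add: "f \<in> A_pos \<Longrightarrow> g \<in> A_pos \<Longrightarrow> (\<lambda>x. f x + g x) \<in> A_pos"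
  by (simp add: affine_functionals_pos_def affine_add)

lemma pos_scale: "f \<in> A_pos \<Longrightarrow> 0 \<le> c \<Longrightarrow> (\<lambda>x. c * f x) \<in> A_pos"
  by (simp add: affine_functionals_pos_def affine_scale)

lemma pos_diff:
  "f \<in> A \<Longrightarrow> g \<in> A \<Longrightarrow> (\<And>x. x \<in> K \<Longrightarrow> g x \<le> f x) \<Longrightarrow> (\<lambda>x. f x - g x) \<in> A_pos"
  by (simp add: affine_functionals_pos_def affine_diff)

lemma abs_le_sup_norm:
  assumes "f \<in> A" "x \<in> K"
  shows "\<bar>f x\<bar> \<le> sup_norm_on K f"
proof -
  have "continuous_on K (\<lambda>x. \<bar>f x\<bar>)"
    using assms by (auto simp: affine_functionals_def intro!: continuous_on_rabs)
  then have "compact ((\<lambda>x. \<bar>f x\<bar>) ` K)" using compact_K by (rule compact_continuous_image)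
  then have "bdd_above ((\<lambda>x. \<bar>f x\<bar>) ` K)"
    by (intro bounded_imp_bdd_above compact_imp_bounded)
  then show ?thesis unfolding sup_norm_on_def using assms by (intro cSUP_upper)
qed

text \<open>The constant 1 is an order unit of A(K), so every element is a difference of two
  positive ones.\<close>

lemma pos_shift:
  assumes "f \<in> A" and "sup_norm_on K f \<le> c"
  shows "(\<lambda>x. f x + c * indicator K x) \<in> A_pos"
proof (rule posI)
  show "(\<lambda>x. f x + c * indicator K x) \<in> A"
    by (intro affine_add affine_scale affine_one assms)
  show "0 \<le> f x + c * indicator K x" if "x \<in> K" for x
    using abs_le_sup_norm[OF assms(1) that] assms(2) that by simp
qed

section \<open>Bounded linear functionals on A(K)\<close>

lemma dualD:
  assumes "\<psi> \<in> A_dual" "f \<in> A"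
  shows "g \<in> A \<Longrightarrow> \<psi> (\<lambda>x. f x + g x) = \<psi> f + \<psi> g"
    and "\<psi> (\<lambda>x. c * f x) = c * \<psi> f"
    and "g \<in> A \<Longrightarrow> \<psi> (\<lambda>x. f x - g x) = \<psi> f - \<psi> g"
    and "\<psi> (\<lambda>x. - f x) = - \<psi> f"
proof -
  show 1: "\<psi> (\<lambda>x. f x + g x) = \<psi> f + \<psi> g" if "g \<in> A" for g
    using assms that by (auto simp: dual_functionals_def)
  have 2: "\<psi> (\<lambda>x. c * f x) = c * \<psi> f" if "f \<in> A" for c f
    using assms(1) that by (auto simp: dual_functionals_def)
  then show "\<psi> (\<lambda>x. c * f x) = c * \<psi> f" using assms(2) .
  show "\<psi> (\<lambda>x. - f x) = - \<psi> f" using 2[OF assms(2), of "- 1"] by simp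
  show "\<psi> (\<lambda>x. f x - g x) = \<psi> f - \<psi> g" if "g \<in> A"
    using 1[OF affine_uminus[OF that]] 2[OF that, of "- 1"] by simp
qed

lemma dual_diff:
  assumes "\<phi> \<in> A_dual" "\<psi> \<in> A_dual"
  shows "(\<lambda>f. \<phi> f - \<psi> f) \<in> A_dual"
proof -
  obtain C D where C: "\<And>f. f \<in> A \<Longrightarrow> \<bar>\<phi> f\<bar> \<le> C * sup_norm_on K f"
    and D: "\<And>f. f \<in> A \<Longrightarrow> \<bar>\<psi> f\<bar> \<le> D * sup_norm_on K f"
    using assms unfolding dual_functionals_def mem_Collect_eq by metis
  have "\<bar>\<phi> f - \<psi> f\<bar> \<le> (C + D) * sup_norm_on K f" if "f \<in> A" for f
    using C[OF that] D[OF that] by (simp add: algebra_simps)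
  moreover have "\<phi> f - \<psi> f = 0" if "f \<notin> A" for f
    using assms that by (simp add: dual_functionals_def)
  ultimately show ?thesis
    using dualD[OF assms(1)] dualD[OF assms(2)]
    by (auto simp: dual_functionals_def right_diff_distrib intro!: exI[of _ "C + D"])
qed

lemma dual_zero: "(\<lambda>f. 0) \<in> A_dual"
  by (auto simp: dual_functionals_def intro: exI[of _ 0])

lemma dual_add:
  assumes "\<phi> \<in> A_dual" "\<psi> \<in> A_dual"
  shows "(\<lambda>f. \<phi> f + \<psi> f) \<in> A_dual"
  using dual_diff[OF assms(1) dual_diff[OF dual_zero assms(2)]] by simp

text \<open>Positivity forces boundedness: both \<open>f\<close> and \<open>- f\<close> are
  dominated by the norm of \<open>f\<close> times the unit, so the value at the unit serves as the
  constant. The conditional provides the extension by zero that \<open>dual_functionals\<close>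
  demands.\<close>

lemma positive_functional_in_dual:
  assumes add: "\<And>f g. f \<in> A \<Longrightarrow> g \<in> A \<Longrightarrow> \<psi> (\<lambda>x. f x + g x) = \<psi> f + \<psi> g"
    and scale: "\<And>c f. f \<in> A \<Longrightarrow> \<psi> (\<lambda>x. c * f x) = c * \<psi> f"
    and pos: "\<And>f. f \<in> A_pos \<Longrightarrow> 0 \<le> \<psi> f"
  shows "(\<lambda>f. if f \<in> A then \<psi> f else 0) \<in> A_dual"
proof -
  have "\<bar>\<psi> f\<bar> \<le> \<psi> (indicator K) * sup_norm_on K f" if f: "f \<in> A" for f
  proof -
    \<comment> \<open>The sign \<open>c\<close> treats \<open>f\<close> and \<open>- f\<close> at
      once.\<close>
    have *: "0 \<le> c * \<psi> f + sup_norm_on K f * \<psi> (indicator K)" if c: "\<bar>c\<bar> = 1" for c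
    proof -
      have "(\<lambda>x. c * f x + sup_norm_on K f * indicator K x) \<in> A_pos"
      proof (rule posI)
        show "(\<lambda>x. c * f x + sup_norm_on K f * indicator K x) \<in> A"
          by (intro affine_add affine_scale f affine_one)
        show "0 \<le> c * f x + sup_norm_on K f * indicator K x" if "x \<in> K" for x
          using abs_le_sup_norm[OF f that] that c abs_mult[of c "f x"] by simp
      qed
      from pos[OF this] show ?thesis
        by (simp add: add scale affine_scale f affine_one)
    qed
    from *[of 1] *[of "- 1"] show ?thesis by (simp add: abs_le_iff algebra_simps)
  qed
  then show ?thesis
    using affine_add affine_scale add scale by (auto simp: dual_functionals_def)
qed

section \<open>The dual order and its lattice operations\<close>

lemma dual_order_le_iff:
  assumes "\<phi> \<in> A_dual" "\<psi> \<in> A_dual"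
  shows "\<phi> \<sqsubseteq>\<^bsub>dual_order K\<^esub> \<psi> \<longleftrightarrow> (\<forall>f\<in>A_pos. \<phi> f \<le> \<psi> f)"
  using dual_diff[OF assms(2,1)] by (simp add: dual_order_def dual_functionals_pos_def)

text \<open>The positive cone spans A(K): \<open>f\<close> is the difference of \<open>f + c\<close>
  and the constant \<open>c\<close>. This gives antisymmetry of the dual order.\<close>

lemma dual_eqI:
  assumes "\<phi> \<in> A_dual" "\<psi> \<in> A_dual" and eq: "\<And>f. f \<in> A_pos \<Longrightarrow> \<phi> f = \<psi> f"
  shows "\<phi> = \<psi>"
proof
  fix f
  show "\<phi> f = \<psi> f"
  proof (cases "f \<in> A")
    case f: True
    define c where "c = \<bar>sup_norm_on K f\<bar>"
    have "(\<lambda>x. f x + c * indicator K x) \<in> A_pos" using f by (rule pos_shift) (simp add: c_def)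
    then have "\<phi> (\<lambda>x. f x + c * indicator K x) = \<psi> (\<lambda>x. f x + c * indicator K x)"
      and "\<phi> (indicator K) = \<psi> (indicator K)"
      using eq pos_one by auto
    then show ?thesis
      by (simp add: dualD[OF assms(1)] dualD[OF assms(2)] f affine_one affine_scale)
  next
    case False
    then show ?thesis using assms by (simp add: dual_functionals_def)
  qed
qed

lemma dual_partial_order: "partial_order (dual_order K)"
proof
  fix x y z w
  show "x .=\<^bsub>dual_order K\<^esub> x" by (simp add: dual_order_def)
  show "y .=\<^bsub>dual_order K\<^esub> x" if "x .=\<^bsub>dual_order K\<^esub> y" using that by (simp add: dual_order_def)
  show "x .=\<^bsub>dual_order K\<^esub> z" if "x .=\<^bsub>dual_order K\<^esub> y" "y .=\<^bsub>dual_order K\<^esub> z"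
    using that by (simp add: dual_order_def)
  show "(x \<sqsubseteq>\<^bsub>dual_order K\<^esub> z) = (y \<sqsubseteq>\<^bsub>dual_order K\<^esub> w)"
    if "x .=\<^bsub>dual_order K\<^esub> y" "z .=\<^bsub>dual_order K\<^esub> w"
    using that by (simp add: dual_order_def)
  show "(.=\<^bsub>dual_order K\<^esub>) = (=)" by (simp add: dual_order_def)
  assume "x \<in> carrier (dual_order K)"
  then have x: "x \<in> A_dual" by (simp add: dual_order_def)
  then show "x \<sqsubseteq>\<^bsub>dual_order K\<^esub> x" by (simp add: dual_order_le_iff)
  assume "y \<in> carrier (dual_order K)"
  then have y: "y \<in> A_dual" by (simp add: dual_order_def)
  show "x .=\<^bsub>dual_order K\<^esub> y" if "x \<sqsubseteq>\<^bsub>dual_order K\<^esub> y" "y \<sqsubseteq>\<^bsub>dual_order K\<^esub> x"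
    using that x y dual_eqI[OF x y]
    by (auto simp: dual_order_le_iff dual_order_def[THEN arg_cong[of _ _ eq]] intro: order_antisym)
  assume "z \<in> carrier (dual_order K)"
  then have z: "z \<in> A_dual" by (simp add: dual_order_def)
  show "x \<sqsubseteq>\<^bsub>dual_order K\<^esub> z" if "x \<sqsubseteq>\<^bsub>dual_order K\<^esub> y" "y \<sqsubseteq>\<^bsub>dual_order K\<^esub> z"
    using that x y z by (auto simp: dual_order_le_iff intro: order_trans)
qed

text \<open>Expresses the meet by inequalities on the positive cone, the form in which Riesz
  decomposition uses it.\<close>

lemma choquet_simplex_inf:
  assumes "choquet_simplex K" and D: "\<phi> \<in> A_dual" "\<psi> \<in> A_dual"
  shows "\<exists>\<gamma>\<in>A_dual. (\<forall>f\<in>A_pos. \<gamma> f \<le> \<phi> f \<and> \<gamma> f \<le> \<psi> f) \<and>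
    (\<forall>\<xi>\<in>A_dual. (\<forall>f\<in>A_pos. \<xi> f \<le> \<phi> f \<and> \<xi> f \<le> \<psi> f) \<longrightarrow> (\<forall>f\<in>A_pos. \<xi> f \<le> \<gamma> f))"
proof -
  interpret L: Lattice.lattice "dual_order K"
    using assms(1) by (simp add: choquet_simplex_def)
  have carrier: "carrier (dual_order K) = A_dual" by (simp add: dual_order_def)
  obtain \<gamma> where \<gamma>: "greatest (dual_order K) \<gamma> (Lower (dual_order K) {\<phi>, \<psi>})"
    using L.inf_of_two_exists[of \<phi> \<psi>] D by (auto simp: carrier)
  then have \<gamma>D: "\<gamma> \<in> A_dual" by (auto simp: greatest_def Lower_def carrier)
  show ?thesis
  proof (intro bexI[OF _ \<gamma>D] conjI ballI impI)
    show "\<gamma> f \<le> \<phi> f" "\<gamma> f \<le> \<psi> f" if "f \<in> A_pos" for f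
      using \<gamma> D \<gamma>D that by (auto simp: greatest_def Lower_def carrier dual_order_le_iff)
    fix \<xi> f assume \<xi>: "\<xi> \<in> A_dual" "\<forall>f\<in>A_pos. \<xi> f \<le> \<phi> f \<and> \<xi> f \<le> \<psi> f" and f: "f \<in> A_pos"
    have "\<xi> \<in> Lower (dual_order K) {\<phi>, \<psi>}"
      using \<xi> D by (auto simp: Lower_def carrier dual_order_le_iff)
    then have "\<xi> \<sqsubseteq>\<^bsub>dual_order K\<^esub> \<gamma>" using \<gamma> by (simp add: greatest_def)
    then show "\<xi> f \<le> \<gamma> f" using \<xi>(1) \<gamma>D f by (simp add: dual_order_le_iff)
  qed
qed

text \<open>Positive parts suffice for a lattice: if \<sigma> is the positive part of \<psi> -
  \<phi>, then \<phi> + \<sigma> is the join and \<psi> - \<sigma> the meet of \<phi> and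
  \<psi>.\<close>

lemma choquet_simplexI:
  assumes pos_part: "\<And>\<psi>. \<psi> \<in> A_dual \<Longrightarrow> \<exists>\<sigma>\<in>A_dual. (\<forall>f\<in>A_pos. 0 \<le> \<sigma> f \<and> \<psi> f \<le> \<sigma> f) \<and>
    (\<forall>\<xi>\<in>A_dual. (\<forall>f\<in>A_pos. 0 \<le> \<xi> f \<and> \<psi> f \<le> \<xi> f) \<longrightarrow> (\<forall>f\<in>A_pos. \<sigma> f \<le> \<xi> f))"
  shows "choquet_simplex K"
proof -
  interpret L: partial_order "dual_order K" by (rule dual_partial_order)
  have carrier: "carrier (dual_order K) = A_dual" by (simp add: dual_order_def)
  show ?thesis
    unfolding choquet_simplex_def
  proof
    fix \<phi> \<psi> assume "\<phi> \<in> carrier (dual_order K)" "\<psi> \<in> carrier (dual_order K)"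
    then have D: "\<phi> \<in> A_dual" "\<psi> \<in> A_dual" by (auto simp: carrier)
    obtain \<sigma> where \<sigma>: "\<sigma> \<in> A_dual" "\<And>f. f \<in> A_pos \<Longrightarrow> 0 \<le> \<sigma> f" "\<And>f. f \<in> A_pos \<Longrightarrow> \<psi> f - \<phi> f \<le> \<sigma> f"
      and least: "\<And>\<xi> f. \<xi> \<in> A_dual \<Longrightarrow> \<forall>f\<in>A_pos. 0 \<le> \<xi> f \<and> \<psi> f - \<phi> f \<le> \<xi> f \<Longrightarrow>
        f \<in> A_pos \<Longrightarrow> \<sigma> f \<le> \<xi> f"
      using pos_part[OF dual_diff[OF D(2,1)]] by blast
    have sup: "(\<lambda>f. \<phi> f + \<sigma> f) \<in> A_dual" using D(1) \<sigma>(1) by (rule dual_add)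
    have inf: "(\<lambda>f. \<psi> f - \<sigma> f) \<in> A_dual" using D(2) \<sigma>(1) by (rule dual_diff)
    show "\<exists>s. least (dual_order K) s (Upper (dual_order K) {\<phi>, \<psi>})"
    proof (rule exI[of _ "\<lambda>f. \<phi> f + \<sigma> f"], unfold least_def, intro conjI ballI)
      show "Upper (dual_order K) {\<phi>, \<psi>} \<subseteq> carrier (dual_order K)" by (auto simp: Upper_def)
      show "(\<lambda>f. \<phi> f + \<sigma> f) \<in> Upper (dual_order K) {\<phi>, \<psi>}"
        using \<sigma>(2,3) sup D by (force simp: Upper_def carrier dual_order_le_iff)
      fix \<xi> assume "\<xi> \<in> Upper (dual_order K) {\<phi>, \<psi>}"
      then have \<xi>: "\<xi> \<in> A_dual" "\<forall>f\<in>A_pos. \<phi> f \<le> \<xi> f" "\<forall>f\<in>A_pos. \<psi> f \<le> \<xi> f"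
        using D by (auto simp: Upper_def carrier dual_order_le_iff)
      have "\<sigma> f \<le> \<xi> f - \<phi> f" if "f \<in> A_pos" for f
        by (rule least[OF dual_diff[OF \<xi>(1) D(1)] _ that]) (use \<xi> in auto)
      then show "(\<lambda>f. \<phi> f + \<sigma> f) \<sqsubseteq>\<^bsub>dual_order K\<^esub> \<xi>"
        using sup \<xi>(1) by (force simp: dual_order_le_iff)
    qed
    show "\<exists>s. greatest (dual_order K) s (Lower (dual_order K) {\<phi>, \<psi>})"
    proof (rule exI[of _ "\<lambda>f. \<psi> f - \<sigma> f"], unfold greatest_def, intro conjI ballI)
      show "Lower (dual_order K) {\<phi>, \<psi>} \<subseteq> carrier (dual_order K)" by (auto simp: Lower_def)
      show "(\<lambda>f. \<psi> f - \<sigma> f) \<in> Lower (dual_order K) {\<phi>, \<psi>}"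
        using \<sigma>(2,3) inf D by (force simp: Lower_def carrier dual_order_le_iff)
      fix \<xi> assume "\<xi> \<in> Lower (dual_order K) {\<phi>, \<psi>}"
      then have \<xi>: "\<xi> \<in> A_dual" "\<forall>f\<in>A_pos. \<xi> f \<le> \<phi> f" "\<forall>f\<in>A_pos. \<xi> f \<le> \<psi> f"
        using D by (auto simp: Lower_def carrier dual_order_le_iff)
      have "\<sigma> f \<le> \<psi> f - \<xi> f" if "f \<in> A_pos" for f
        by (rule least[OF dual_diff[OF D(2) \<xi>(1)] _ that]) (use \<xi> in auto)
      then show "\<xi> \<sqsubseteq>\<^bsub>dual_order K\<^esub> (\<lambda>f. \<psi> f - \<sigma> f)"
        using inf \<xi>(1) by (force simp: dual_order_le_iff)
    qed
  qed
qed

section \<open>Positive parts from compatibility\<close>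

lemma dual_bounded_on_order_interval:
  assumes "\<psi> \<in> A_dual"
  obtains B where "\<And>g. g \<in> A \<Longrightarrow> (\<And>x. x \<in> K \<Longrightarrow> \<bar>g x\<bar> \<le> c) \<Longrightarrow> \<psi> g \<le> B"
proof -
  obtain C where C: "\<And>f. f \<in> A \<Longrightarrow> \<bar>\<psi> f\<bar> \<le> C * sup_norm_on K f"
    using assms unfolding dual_functionals_def mem_Collect_eq by metis
  show thesis
  proof (cases "K = {}")
    case True
    \<comment> \<open>Over the empty set the supremum is one fixed default value, so all functions
      share the same norm and a single bound serves for all of them.\<close>
    show thesis
      using C True by (intro that[of "C * sup_norm_on K (\<lambda>x. 0)"]) (force simp: sup_norm_on_def)
  next
    case False
    then obtain y where y: "y \<in> K" by blast
    show thesis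
    proof (rule that[of "\<bar>C\<bar> * c"])
      fix g assume g: "g \<in> A" "\<And>x. x \<in> K \<Longrightarrow> \<bar>g x\<bar> \<le> c"
      have "sup_norm_on K g \<le> c"
        unfolding sup_norm_on_def using False g(2) by (intro cSUP_least)
      moreover have "0 \<le> sup_norm_on K g" using abs_le_sup_norm[OF g(1) y] by linarith
      ultimately have "C * sup_norm_on K g \<le> \<bar>C\<bar> * c" by (intro mult_mono) auto
      then show "\<psi> g \<le> \<bar>C\<bar> * c" using C[OF g(1)] by linarith
    qed
  qed
qed

text \<open>Here \<open>I f\<close> is the order interval from 0 to \<open>f\<close>, and
  \<open>p\<close> is the Riesz-Kantorovich formula for the positive part. The assumption
  \<open>compat\<close> only splits functions below 1; homogeneity carries the resulting additivity
  to the whole cone.\<close>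

lemma positive_part_exists:
  assumes compat: "\<And>f g. f \<in> A_pos \<Longrightarrow> g \<in> A_pos \<Longrightarrow> (\<And>x. x \<in> K \<Longrightarrow> f x \<le> 1 \<and> g x \<le> 1) \<Longrightarrow>
      \<exists>h\<in>A_pos. \<forall>x\<in>K. h x \<le> f x \<and> h x \<le> g x \<and> f x + g x - 1 \<le> h x"
    and \<psi>: "\<psi> \<in> A_dual"
  shows "\<exists>\<sigma>\<in>A_dual. (\<forall>f\<in>A_pos. 0 \<le> \<sigma> f \<and> \<psi> f \<le> \<sigma> f) \<and>
    (\<forall>\<xi>\<in>A_dual. (\<forall>f\<in>A_pos. 0 \<le> \<xi> f \<and> \<psi> f \<le> \<xi> f) \<longrightarrow> (\<forall>f\<in>A_pos. \<sigma> f \<le> \<xi> f))"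
proof -
  define I where "I f = {g \<in> A_pos. \<forall>x\<in>K. g x \<le> f x}" for f
  define p where "p f = (SUP g\<in>I f. \<psi> g)" for f
  have I_A: "g \<in> A" if "g \<in> I f" for f g using that by (auto simp: I_def posD)
  have p_upper: "\<psi> g \<le> p f" if f: "f \<in> A_pos" and g: "g \<in> I f" for f g
  proof -
    obtain B where B: "\<And>g. g \<in> A \<Longrightarrow> (\<And>x. x \<in> K \<Longrightarrow> \<bar>g x\<bar> \<le> sup_norm_on K f) \<Longrightarrow> \<psi> g \<le> B"
      using dual_bounded_on_order_interval[OF \<psi>] by metis
    have "\<psi> g \<le> B" if "g \<in> I f" for g
    proof (rule B[OF I_A[OF that]])
      fix x assume x: "x \<in> K"
      then have "0 \<le> g x" "g x \<le> f x" using that by (auto simp: I_def posD)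
      then show "\<bar>g x\<bar> \<le> sup_norm_on K f"
        using abs_le_sup_norm[OF posD(1)[OF f] x] by simp
    qed
    then have "bdd_above (\<psi> ` I f)" by (intro bdd_aboveI2)
    then show ?thesis unfolding p_def using g by (intro cSUP_upper)
  qed
  have zero_I: "(\<lambda>x. 0) \<in> I f" if "f \<in> A_pos" for f
    using that by (auto simp: I_def posD pos_zero)
  have p_least: "p f \<le> b" if "f \<in> A_pos" "\<And>g. g \<in> I f \<Longrightarrow> \<psi> g \<le> b" for f b
    unfolding p_def using zero_I[OF that(1)] that(2) by (intro cSUP_least) auto
  have \<psi>0: "\<psi> (\<lambda>x. 0) = 0" using dualD(2)[OF \<psi> affine_zero, of 0] by simp
  have p_nonneg: "0 \<le> p f" if "f \<in> A_pos" for f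
    using p_upper[OF that zero_I[OF that]] \<psi>0 by simp
  have p_ge: "\<psi> f \<le> p f" if "f \<in> A_pos" for f
    using that by (intro p_upper) (auto simp: I_def)
  have p_super: "p f + p g \<le> p (\<lambda>x. f x + g x)" if f: "f \<in> A_pos" and g: "g \<in> A_pos" for f g
  proof -
    have "\<psi> a + \<psi> b \<le> p (\<lambda>x. f x + g x)" if "a \<in> I f" "b \<in> I g" for a b
    proof -
      have "(\<lambda>x. a x + b x) \<in> I (\<lambda>x. f x + g x)"
        using that by (auto simp: I_def pos_add intro: add_mono)
      then show ?thesis
        using p_upper[OF pos_add[OF f g]] dualD(1)[OF \<psi> I_A[OF that(1)] I_A[OF that(2)]] by fastforce
    qed
    \<comment> \<open>The suprema are taken one at a time, first over \<open>b\<close> and then over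
      \<open>a\<close>.\<close>
    then have "\<psi> a \<le> p (\<lambda>x. f x + g x) - p g" if "a \<in> I f" for a
      using p_least[OF g, of "p (\<lambda>x. f x + g x) - \<psi> a"] that by fastforce
    from p_least[OF f this] show ?thesis by simp
  qed
  have p_scale_ge: "c * p f \<le> p (\<lambda>x. c * f x)" if f: "f \<in> A_pos" and c: "0 < c" for c f
  proof -
    have "\<psi> g \<le> p (\<lambda>x. c * f x) / c" if g: "g \<in> I f" for g
    proof -
      have "(\<lambda>x. c * g x) \<in> I (\<lambda>x. c * f x)" using g c by (auto simp: I_def pos_scale)
      from p_upper[OF pos_scale[OF f] this] show ?thesis
        using c dualD(2)[OF \<psi> I_A[OF g], of c] by (simp add: field_simps)
    qed
    from p_least[OF f this] show ?thesis using c by (simp add: field_simps)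
  qed
  have p_pos_scale: "p (\<lambda>x. c * f x) = c * p f" if f: "f \<in> A_pos" and c: "0 < c" for c f
  proof (rule antisym)
    have "(1 / c) * p (\<lambda>x. c * f x) \<le> p (\<lambda>x. (1 / c) * (c * f x))"
      using f c by (intro p_scale_ge pos_scale) auto
    then show "p (\<lambda>x. c * f x) \<le> c * p f" using c by (simp add: field_simps)
  qed (rule p_scale_ge[OF f c])
  let ?u = "indicator K :: 'a \<Rightarrow> real"
  have p_compl: "p f + p (\<lambda>x. ?u x - f x) = p ?u"
    if f: "f \<in> A_pos" and f1: "\<And>x. x \<in> K \<Longrightarrow> f x \<le> 1" for f
  proof (rule antisym)
    have cf: "(\<lambda>x. ?u x - f x) \<in> A_pos" using f f1 by (intro pos_diff affine_one) (auto simp: posD)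
    then show "p f + p (\<lambda>x. ?u x - f x) \<le> p ?u" using p_super[OF f] by fastforce
    show "p ?u \<le> p f + p (\<lambda>x. ?u x - f x)"
    proof (rule p_least[OF pos_one])
      fix g assume g: "g \<in> I ?u"
      then have g1: "g \<in> A_pos" "\<And>x. x \<in> K \<Longrightarrow> g x \<le> 1" by (auto simp: I_def)
      \<comment> \<open>The split \<open>g = h + (g - h)\<close> has \<open>h \<le> f\<close>, and
        the lower bound \<open>f + g - 1 \<le> h\<close> is exactly
        \<open>g - h \<le> 1 - f\<close>.\<close>
      then obtain h where h: "h \<in> A_pos"
        "\<And>x. x \<in> K \<Longrightarrow> h x \<le> f x \<and> h x \<le> g x \<and> f x + g x - 1 \<le> h x"
        using compat[OF f g1(1)] f1 by blast
      have "(\<lambda>x. g x - h x) \<in> A_pos"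
        using h(2) by (intro pos_diff posD(1)[OF g1(1)] posD(1)[OF h(1)]) blast
      moreover have "g x - h x \<le> ?u x - f x" if "x \<in> K" for x
        using h(2)[OF that] that by simp
      ultimately have "h \<in> I f" "(\<lambda>x. g x - h x) \<in> I (\<lambda>x. ?u x - f x)"
        using h by (auto simp: I_def)
      then have "\<psi> h + \<psi> (\<lambda>x. g x - h x) \<le> p f + p (\<lambda>x. ?u x - f x)"
        using p_upper f cf by (intro add_mono)
      then show "\<psi> g \<le> p f + p (\<lambda>x. ?u x - f x)"
        using dualD(3)[OF \<psi> posD(1)[OF g1(1)] posD(1)[OF h(1)]] by simp
    qed
  qed
  \<comment> \<open>\<open>p\<close> is concave, and \<open>p f = p 1 - p (1 - f)\<close> on the unit interval makes it convex as well.\<close>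
  have p_add_unit: "p (\<lambda>x. f x + g x) = p f + p g"
    if f: "f \<in> A_pos" "\<And>x. x \<in> K \<Longrightarrow> f x \<le> 1" and g: "g \<in> A_pos" "\<And>x. x \<in> K \<Longrightarrow> g x \<le> 1" for f g
  proof (rule antisym)
    \<comment> \<open>The sum \<open>f + g\<close> may exceed 1, so the complement formula is
      applied to the midpoint.\<close>
    define m where "m = (\<lambda>x. (1 / 2) * (f x + g x))"
    have m: "m \<in> A_pos" unfolding m_def using f g by (intro pos_scale pos_add) auto
    have m1: "m x \<le> 1" if "x \<in> K" for x using f(2)[OF that] g(2)[OF that] by (simp add: m_def)
    have cf: "(\<lambda>x. ?u x - f x) \<in> A_pos" and cg: "(\<lambda>x. ?u x - g x) \<in> A_pos"
      using f g by (auto intro!: pos_diff affine_one simp: posD)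
    have "(\<lambda>x. ?u x - m x) = (\<lambda>x. (1 / 2) * (?u x - f x) + (1 / 2) * (?u x - g x))"
      by (simp add: m_def fun_eq_iff field_simps)
    \<comment> \<open>Superadditivity at the complements becomes, through \<open>p_compl\<close>,
      the missing upper bound for \<open>p m\<close>.\<close>
    then have "(1 / 2) * p (\<lambda>x. ?u x - f x) + (1 / 2) * p (\<lambda>x. ?u x - g x) \<le> p (\<lambda>x. ?u x - m x)"
      using p_super[OF pos_scale[OF cf, of "1 / 2"] pos_scale[OF cg, of "1 / 2"]]
        p_pos_scale[OF cf, of "1 / 2"] p_pos_scale[OF cg, of "1 / 2"] by simp
    moreover have "p m = (1 / 2) * p (\<lambda>x. f x + g x)"
      unfolding m_def by (intro p_pos_scale pos_add f g) simp
    ultimately show "p (\<lambda>x. f x + g x) \<le> p f + p g"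
      using p_compl[OF m m1] p_compl[OF f] p_compl[OF g] by simp
  qed (rule p_super[OF f(1) g(1)])
  have p_add: "p (\<lambda>x. f x + g x) = p f + p g" if f: "f \<in> A_pos" and g: "g \<in> A_pos" for f g
  proof -
    \<comment> \<open>Division by \<open>c\<close> brings both functions below 1; the summand 1
      keeps \<open>c\<close> positive when the norms vanish.\<close>
    define c where "c = \<bar>sup_norm_on K f\<bar> + \<bar>sup_norm_on K g\<bar> + 1"
    have c: "0 < c" by (simp add: c_def)
    have fc: "f x \<le> c" and gc: "g x \<le> c" if "x \<in> K" for x
      using abs_le_sup_norm[OF posD(1)[OF f] that] abs_le_sup_norm[OF posD(1)[OF g] that]
      by (auto simp: c_def)
    have "p (\<lambda>x. (1 / c) * f x + (1 / c) * g x) = p (\<lambda>x. (1 / c) * f x) + p (\<lambda>x. (1 / c) * g x)"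
      using c f g fc gc by (intro p_add_unit pos_scale) (auto simp: field_simps)
    also have "\<dots> = (1 / c) * (p f + p g)"
      using c f g p_pos_scale[of _ "1 / c"] by (simp add: algebra_simps)
    finally have "p (\<lambda>x. (1 / c) * (f x + g x)) = (1 / c) * (p f + p g)"
      by (simp add: algebra_simps)
    then show ?thesis using p_pos_scale[OF pos_add[OF f g], of "1 / c"] c by simp
  qed
  have p_zero: "p (\<lambda>x. 0) = 0" using p_add[OF pos_zero pos_zero] by simp
  have p_scale: "p (\<lambda>x. c * f x) = c * p f" if "f \<in> A_pos" "0 \<le> c" for c f
    using that p_pos_scale[of f c] p_zero by (cases "c = 0") auto
  \<comment> \<open>The absolute value makes \<open>N f\<close> nonnegative even for empty
    \<open>K\<close>, where the norm is a default value. The shift by \<open>N f\<close> moves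
    \<open>f\<close> into the cone, and \<sigma> subtracts its contribution again.\<close>
  define N where "N f = \<bar>sup_norm_on K f\<bar>" for f :: "'a \<Rightarrow> real"
  define \<sigma> where "\<sigma> f = p (\<lambda>x. f x + N f * ?u x) - N f * p ?u" for f
  have N: "0 \<le> N f" "f \<in> A \<Longrightarrow> (\<lambda>x. f x + N f * ?u x) \<in> A_pos" for f
    by (auto simp: N_def intro!: pos_shift)
  have \<sigma>_eq: "\<sigma> f = p (\<lambda>x. f x + c * ?u x) - c * p ?u"
    if f: "f \<in> A" and c: "0 \<le> c" and fc: "(\<lambda>x. f x + c * ?u x) \<in> A_pos" for f c
  proof -
    \<comment> \<open>Two admissible shifts are compared by applying both, in either order; hence
      \<sigma> does not depend on the shift chosen.\<close>
    have "p (\<lambda>x. f x + N f * ?u x) + p (\<lambda>x. c * ?u x) = p (\<lambda>x. (f x + N f * ?u x) + c * ?u x)"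
      by (rule p_add[symmetric]) (intro N f pos_scale pos_one c)+
    also have "\<dots> = p (\<lambda>x. (f x + c * ?u x) + N f * ?u x)"
      by (simp add: algebra_simps)
    also have "\<dots> = p (\<lambda>x. f x + c * ?u x) + p (\<lambda>x. N f * ?u x)"
      by (rule p_add) (intro N fc pos_scale pos_one)+
    finally show ?thesis
      using p_scale[OF pos_one c] p_scale[OF pos_one N(1)[of f]] by (simp add: \<sigma>_def)
  qed
  have \<sigma>_add: "\<sigma> (\<lambda>x. f x + g x) = \<sigma> f + \<sigma> g" if f: "f \<in> A" and g: "g \<in> A" for f g
  proof -
    have eq: "(\<lambda>x. (f x + g x) + (N f + N g) * ?u x) = (\<lambda>x. (f x + N f * ?u x) + (g x + N g * ?u x))"
      by (simp add: fun_eq_iff algebra_simps)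
    have "(\<lambda>x. (f x + g x) + (N f + N g) * ?u x) \<in> A_pos"
      unfolding eq by (intro pos_add N f g)
    then have "\<sigma> (\<lambda>x. f x + g x) = p (\<lambda>x. (f x + g x) + (N f + N g) * ?u x) - (N f + N g) * p ?u"
      using N(1)[of f] N(1)[of g] by (intro \<sigma>_eq affine_add f g) auto
    then show ?thesis
      unfolding eq using p_add[OF N(2)[OF f] N(2)[OF g]] by (simp add: \<sigma>_def algebra_simps)
  qed
  have \<sigma>_pos: "\<sigma> f = p f" if "f \<in> A_pos" for f
    using \<sigma>_eq[OF posD(1)[OF that], of 0] that by simp
  have \<sigma>_pos_scale: "\<sigma> (\<lambda>x. c * f x) = c * \<sigma> f" if f: "f \<in> A" and c: "0 \<le> c" for c f
  proof -
    have eq: "(\<lambda>x. c * f x + (c * N f) * ?u x) = (\<lambda>x. c * (f x + N f * ?u x))"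
      by (simp add: fun_eq_iff algebra_simps)
    have "(\<lambda>x. c * f x + (c * N f) * ?u x) \<in> A_pos"
      unfolding eq by (intro pos_scale N f c)
    then have "\<sigma> (\<lambda>x. c * f x) = p (\<lambda>x. c * f x + (c * N f) * ?u x) - (c * N f) * p ?u"
      using N(1)[of f] c by (intro \<sigma>_eq affine_scale f) auto
    then show ?thesis
      unfolding eq using p_scale[OF N(2)[OF f] c] by (simp add: \<sigma>_def algebra_simps)
  qed
  have \<sigma>_neg: "\<sigma> (\<lambda>x. - f x) = - \<sigma> f" if f: "f \<in> A" for f
    using \<sigma>_add[OF f affine_uminus[OF f]] \<sigma>_pos[OF pos_zero] p_zero by simp
  have \<sigma>_scale: "\<sigma> (\<lambda>x. c * f x) = c * \<sigma> f" if f: "f \<in> A" for c f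
  proof (cases "0 \<le> c")
    case True
    then show ?thesis by (rule \<sigma>_pos_scale[OF f])
  next
    case False
    then show ?thesis using \<sigma>_neg[OF affine_scale[OF f, of "- c"]] \<sigma>_pos_scale[OF f, of "- c"] by simp
  qed
  show ?thesis
  proof (intro bexI conjI ballI impI)
    show "(\<lambda>f. if f \<in> A then \<sigma> f else 0) \<in> A_dual"
      using \<sigma>_add \<sigma>_scale by (rule positive_functional_in_dual) (simp_all add: \<sigma>_pos p_nonneg)
    fix f assume f: "f \<in> A_pos"
    then show "0 \<le> (if f \<in> A then \<sigma> f else 0)" "\<psi> f \<le> (if f \<in> A then \<sigma> f else 0)"
      by (simp_all add: posD \<sigma>_pos p_nonneg p_ge)
    fix \<xi> assume \<xi>: "\<xi> \<in> A_dual" "\<forall>f\<in>A_pos. 0 \<le> \<xi> f \<and> \<psi> f \<le> \<xi> f"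
    have "p f \<le> \<xi> f"
    proof (rule p_least[OF f])
      fix g assume g: "g \<in> I f"
      then have "\<psi> g \<le> \<xi> g" using \<xi> by (auto simp: I_def)
      moreover have "0 \<le> \<xi> (\<lambda>x. f x - g x)"
        using \<xi>(2) pos_diff[OF posD(1)[OF f] I_A[OF g]] g by (auto simp: I_def)
      ultimately show "\<psi> g \<le> \<xi> f"
        using dualD(3)[OF \<xi>(1) posD(1)[OF f] I_A[OF g]] by simp
    qed
    then show "(if f \<in> A then \<sigma> f else 0) \<le> \<xi> f" using f by (simp add: posD \<sigma>_pos)
  qed
qed

section \<open>Interpolation in a simplex\<close>

text \<open>Solvability of the four inequalities is membership of a quadruple in a cone, so failure
  yields a separating functional. The margin \<epsilon> compensates for the weak inequality that
  \<open>cone_separation\<close> gives at the excluded point.\<close>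

lemma approximate_interpolation:
  assumes simplex: "choquet_simplex K" and A: "u1 \<in> A" "u2 \<in> A" "v1 \<in> A" "v2 \<in> A"
    and le: "\<And>x. x \<in> K \<Longrightarrow> u1 x \<le> v1 x \<and> u1 x \<le> v2 x \<and> u2 x \<le> v1 x \<and> u2 x \<le> v2 x"
    and \<epsilon>: "0 < \<epsilon>"
  shows "\<exists>h\<in>A. \<forall>x\<in>K. u1 x - \<epsilon> \<le> h x \<and> u2 x - \<epsilon> \<le> h x \<and> h x \<le> v1 x + \<epsilon> \<and> h x \<le> v2 x + \<epsilon>"
proof (rule ccontr)
  assume contra: "\<not> ?thesis"
  let ?u = "indicator K :: 'a \<Rightarrow> real" and ?o = "(\<lambda>x. 0) :: 'a \<Rightarrow> real"
  define W where "W = A \<times> A \<times> A \<times> A"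
  \<comment> \<open>Quadruples that become nonnegative after adding \<open>(h, h, - h, - h)\<close>
    for some \<open>h\<close>, the unknown interpolant.\<close>
  define Q where "Q = {(a, b, c, d) |a b c d. a \<in> A \<and> b \<in> A \<and> c \<in> A \<and> d \<in> A \<and>
    (\<exists>h\<in>A. \<forall>x\<in>K. 0 \<le> a x + h x \<and> 0 \<le> b x + h x \<and> 0 \<le> c x - h x \<and> 0 \<le> d x - h x)}"
  have QI: "(a, b, c, d) \<in> Q" if "a \<in> A" "b \<in> A" "c \<in> A" "d \<in> A" "h \<in> A"
    "\<And>x. x \<in> K \<Longrightarrow> 0 \<le> a x + h x \<and> 0 \<le> b x + h x \<and> 0 \<le> c x - h x \<and> 0 \<le> d x - h x" for a b c d h
    using that unfolding Q_def by blast
  have QE: "\<exists>a b c d h. q = (a, b, c, d) \<and> a \<in> A \<and> b \<in> A \<and> c \<in> A \<and> d \<in> A \<and> h \<in> A \<and>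
    (\<forall>x\<in>K. 0 \<le> a x + h x \<and> 0 \<le> b x + h x \<and> 0 \<le> c x - h x \<and> 0 \<le> d x - h x)" if "q \<in> Q" for q
    using that unfolding Q_def by blast
  note fun_ops = zero_prod_def zero_fun_def plus_fun_def scaleR_fun_def
  have W: "subspace W"
    by (auto simp: subspace_def W_def fun_ops affine_add affine_scale affine_zero)
  have QW: "Q \<subseteq> W" by (auto simp: Q_def W_def)
  have cone: "convex_cone Q"
    unfolding convex_cone_iff
  proof (intro conjI ballI allI impI)
    show "0 \<in> Q"
      unfolding fun_ops by (rule QI[of _ _ _ _ ?o]) (auto simp: affine_zero)
    fix p assume "p \<in> Q"
    from QE[OF this] obtain a b c d h where p: "p = (a, b, c, d)" "a \<in> A" "b \<in> A" "c \<in> A" "d \<in> A" "h \<in> A"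
      "\<forall>x\<in>K. 0 \<le> a x + h x \<and> 0 \<le> b x + h x \<and> 0 \<le> c x - h x \<and> 0 \<le> d x - h x" by blast
    show "p + q \<in> Q" if "q \<in> Q" for q
    proof -
      from QE[OF that] obtain a' b' c' d' h' where q: "q = (a', b', c', d')"
        "a' \<in> A" "b' \<in> A" "c' \<in> A" "d' \<in> A" "h' \<in> A"
        "\<forall>x\<in>K. 0 \<le> a' x + h' x \<and> 0 \<le> b' x + h' x \<and> 0 \<le> c' x - h' x \<and> 0 \<le> d' x - h' x" by blast
      show ?thesis
        unfolding p(1) q(1) fun_ops add_Pair
        by (rule QI[of _ _ _ _ "\<lambda>x. h x + h' x"]) (use p q in \<open>force intro!: affine_add\<close>)+
    qed
    show "t *\<^sub>R p \<in> Q" if "0 \<le> t" for t :: real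
    proof -
      have "0 \<le> t * a x + t * h x \<and> 0 \<le> t * b x + t * h x \<and> 0 \<le> t * c x - t * h x \<and> 0 \<le> t * d x - t * h x"
        if "x \<in> K" for x
        using p(7) that \<open>0 \<le> t\<close> by (simp flip: distrib_left right_diff_distrib)
      then show ?thesis
        unfolding p(1) scaleR_Pair scaleR_fun_def real_scaleR_def
        using p(2-6) by (intro QI[of _ _ _ _ "\<lambda>x. t * h x"]) (auto intro!: affine_scale)
    qed
  qed
  define e where "e = (?u, ?u, ?u, ?u)"
  have e: "e \<in> Q"
    unfolding e_def by (rule QI[of _ _ _ _ ?o]) (auto simp: affine_zero affine_one)
  have unit: "\<forall>v\<in>W. \<exists>t. t *\<^sub>R e + v \<in> Q"
  proof
    fix v assume "v \<in> W"
    then obtain a b c d where v: "v = (a, b, c, d)" "a \<in> A" "b \<in> A" "c \<in> A" "d \<in> A"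
      by (auto simp: W_def)
    define t where "t = \<bar>sup_norm_on K a\<bar> + \<bar>sup_norm_on K b\<bar> + \<bar>sup_norm_on K c\<bar> + \<bar>sup_norm_on K d\<bar>"
    have t: "0 \<le> t * ?u x + f x" if "f \<in> {a, b, c, d}" "x \<in> K" for f x
      using that abs_le_sup_norm[of f x] v by (auto simp: t_def)
    have "t *\<^sub>R e + v \<in> Q"
      unfolding e_def v(1) scaleR_Pair add_Pair scaleR_fun_def plus_fun_def real_scaleR_def
      using v t by (intro QI[of _ _ _ _ ?o]) (auto intro!: affine_add affine_scale affine_one affine_zero)
    then show "\<exists>t. t *\<^sub>R e + v \<in> Q" ..
  qed
  \<comment> \<open>The lower bounds enter with a minus sign, so that
    \<open>w + \<epsilon> e \<in> Q\<close> says that some \<open>h\<close> interpolates up to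
    \<epsilon>.\<close>
  define w :: "('a \<Rightarrow> real) \<times> ('a \<Rightarrow> real) \<times> ('a \<Rightarrow> real) \<times> ('a \<Rightarrow> real)"
    where "w = (\<lambda>x. - u1 x, \<lambda>x. - u2 x, v1, v2)"
  have w: "w \<in> W" using A by (auto simp: w_def W_def affine_uminus)
  have zW: "w + \<epsilon> *\<^sub>R e \<in> W" using W w e QW by (auto intro!: subspace_add subspace_scale)
  have zQ: "w + \<epsilon> *\<^sub>R e \<notin> Q"
  proof
    assume "w + \<epsilon> *\<^sub>R e \<in> Q"
    from QE[OF this] obtain h where "h \<in> A" "\<forall>x\<in>K. 0 \<le> - u1 x + \<epsilon> * ?u x + h x \<and>
      0 \<le> - u2 x + \<epsilon> * ?u x + h x \<and> 0 \<le> v1 x + \<epsilon> * ?u x - h x \<and> 0 \<le> v2 x + \<epsilon> * ?u x - h x"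
      by (auto simp: w_def e_def fun_ops)
    then have "h \<in> A" "\<forall>x\<in>K. u1 x - \<epsilon> \<le> h x \<and> u2 x - \<epsilon> \<le> h x \<and> h x \<le> v1 x + \<epsilon> \<and> h x \<le> v2 x + \<epsilon>"
      by (auto simp: algebra_simps)
    then show False using contra by blast
  qed
  obtain \<Phi> where \<Phi>: "\<forall>v\<in>W. \<forall>w\<in>W. \<Phi> (v + w) = \<Phi> v + \<Phi> w"
    "\<forall>c. \<forall>v\<in>W. \<Phi> (c *\<^sub>R v) = c * \<Phi> v" "\<forall>q\<in>Q. 0 \<le> \<Phi> q"
    and \<Phi>z: "\<Phi> (w + \<epsilon> *\<^sub>R e) \<le> 0" and \<Phi>e: "\<Phi> e = 1"
    using cone_separation[OF W QW cone e unit zW zQ] by (elim exE conjE) (rule that)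
  note \<Phi>_add = bspec[OF bspec[OF \<Phi>(1)]] and \<Phi>_scale = bspec[OF spec[OF \<Phi>(2)]]
    and \<Phi>_pos = bspec[OF \<Phi>(3)]
  have eW: "e \<in> W" "\<epsilon> *\<^sub>R e \<in> W" using e QW W subspace_scale by blast+
  \<comment> \<open>Since \<Phi> is 1 at \<open>e\<close>, its value at \<open>w\<close> is at most
    - \<epsilon>.\<close>
  then have \<Phi>w: "\<Phi> w < 0" using \<Phi>z \<Phi>e \<Phi>_add[OF w eW(2)] \<Phi>_scale[OF eW(1), of \<epsilon>] \<epsilon> by simp
  \<comment> \<open>Embedding into coordinate \<open>i\<close> of the quadruple, with coordinates
    counted from 0; \<open>\<phi> i\<close> is the matching component of \<Phi>.\<close>
  define inj where "inj i f = (if i = 0 then f else ?o, if i = 1 then f else ?o,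
    if i = 2 then f else ?o, if i = 3 then f else ?o)" for i :: nat and f
  define \<phi> where "\<phi> i f = (if f \<in> A then \<Phi> (inj i f) else 0)" for i f
  have inj_W: "inj i f \<in> W" if "f \<in> A" for i f using that affine_zero by (auto simp: inj_def W_def)
  have inj_Q: "inj i f \<in> Q" if "f \<in> A_pos" for i f
    unfolding inj_def
    by (rule QI[of _ _ _ _ ?o]) (use that posD affine_zero in auto)
  have inj_add: "inj i (\<lambda>x. f x + g x) = inj i f + inj i g" for i f g
    by (simp add: inj_def fun_ops)
  have inj_scale: "inj i (\<lambda>x. c * f x) = c *\<^sub>R inj i f" for i c f
    by (simp add: inj_def fun_ops)
  have D: "\<phi> i \<in> A_dual" for i
    unfolding \<phi>_def
    by (rule positive_functional_in_dual)
      (simp_all add: inj_add inj_scale \<Phi>_add \<Phi>_scale inj_W \<Phi>_pos inj_Q)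
  have \<phi>_pos: "0 \<le> \<phi> i f" if "f \<in> A_pos" for i f
    using that \<Phi>_pos[OF inj_Q] by (simp add: \<phi>_def)
  have \<Phi>_eq: "\<Phi> (a, b, c, d) = \<phi> 0 a + \<phi> 1 b + \<phi> 2 c + \<phi> 3 d"
    if "a \<in> A" "b \<in> A" "c \<in> A" "d \<in> A" for a b c d
  proof -
    have "(a, b, c, d) = inj 0 a + (inj 1 b + (inj 2 c + inj 3 d))"
      by (simp add: inj_def fun_ops)
    then show ?thesis
      using that by (simp add: \<phi>_def \<Phi>_add inj_W subspace_add[OF W])
  qed
  \<comment> \<open>The quadruple \<open>(f, f, - f, - f)\<close> lies in \<open>Q\<close> for every
    sign of \<open>f\<close>, with witness \<open>- f\<close>. Replacing \<open>f\<close> by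
    \<open>- f\<close> turns the inequality into the equation \<open>balance\<close>.\<close>
  have ge: "\<phi> 2 f + \<phi> 3 f \<le> \<phi> 0 f + \<phi> 1 f" if f: "f \<in> A" for f
  proof -
    have "(f, f, \<lambda>x. - f x, \<lambda>x. - f x) \<in> Q"
      by (rule QI[of _ _ _ _ "\<lambda>x. - f x"]) (auto intro: f affine_uminus)
    from \<Phi>_pos[OF this] show ?thesis
      by (simp add: \<Phi>_eq f affine_uminus dualD(4)[OF D f])
  qed
  have balance: "\<phi> 0 f + \<phi> 1 f = \<phi> 2 f + \<phi> 3 f" if f: "f \<in> A" for f
    using ge[OF f] ge[OF affine_uminus[OF f]] by (simp add: dualD(4)[OF D f])
  \<comment> \<open>Riesz decomposition: \<open>\<gamma>\<close>, \<open>\<phi> 0 - \<gamma>\<close>, \<open>\<phi> 2 - \<gamma>\<close>, \<open>\<phi> 1 - \<phi> 2 + \<gamma>\<close> are positive and form a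
    \<open>2 \<times> 2\<close> table with row sums \<open>\<phi> 0\<close>, \<open>\<phi> 1\<close> and column sums \<open>\<phi> 2\<close>, \<open>\<phi> 3\<close>.\<close>
  obtain \<gamma> where \<gamma>: "\<gamma> \<in> A_dual" "\<And>f. f \<in> A_pos \<Longrightarrow> \<gamma> f \<le> \<phi> 0 f \<and> \<gamma> f \<le> \<phi> 2 f"
    and greatest: "\<And>\<xi> f. \<xi> \<in> A_dual \<Longrightarrow> \<forall>f\<in>A_pos. \<xi> f \<le> \<phi> 0 f \<and> \<xi> f \<le> \<phi> 2 f \<Longrightarrow>
      f \<in> A_pos \<Longrightarrow> \<xi> f \<le> \<gamma> f"
    using choquet_simplex_inf[OF simplex D[of 0] D[of 2]] by blast
  have \<gamma>_pos: "0 \<le> \<gamma> f" if "f \<in> A_pos" for f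
    using greatest[OF dual_zero _ that] \<phi>_pos by blast
  \<comment> \<open>By \<open>balance\<close>, \<open>\<phi> 2 - \<phi> 1\<close> is also a common
    lower bound of \<open>\<phi> 0\<close> and \<open>\<phi> 2\<close>; this makes the fourth table
    entry positive.\<close>
  have \<gamma>_ge: "\<phi> 2 f - \<phi> 1 f \<le> \<gamma> f" if "f \<in> A_pos" for f
  proof (rule greatest[OF dual_diff[OF D D] _ that], intro ballI conjI)
    fix g assume g: "g \<in> A_pos"
    show "\<phi> 2 g - \<phi> 1 g \<le> \<phi> 0 g" using balance[OF posD(1)[OF g]] \<phi>_pos[OF g, of 3] by simp
    show "\<phi> 2 g - \<phi> 1 g \<le> \<phi> 2 g" using \<phi>_pos[OF g, of 1] by simp
  qed
  have diffs: "(\<lambda>x. v1 x - u1 x) \<in> A_pos" "(\<lambda>x. v2 x - u1 x) \<in> A_pos"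
    "(\<lambda>x. v1 x - u2 x) \<in> A_pos" "(\<lambda>x. v2 x - u2 x) \<in> A_pos"
    using A le by (auto intro!: pos_diff)
  \<comment> \<open>Rows belong to \<open>u1\<close>, \<open>u2\<close> and columns to
    \<open>v1\<close>, \<open>v2\<close>. Each entry is evaluated at its column bound minus its row
    bound, and the four inequalities add up to \<open>0 \<le> \<Phi> w\<close>.\<close>
  have "0 \<le> \<gamma> (\<lambda>x. v1 x - u1 x)"
    "\<gamma> (\<lambda>x. v2 x - u1 x) \<le> \<phi> 0 (\<lambda>x. v2 x - u1 x)"
    "\<gamma> (\<lambda>x. v1 x - u2 x) \<le> \<phi> 2 (\<lambda>x. v1 x - u2 x)"
    "\<phi> 2 (\<lambda>x. v2 x - u2 x) - \<phi> 1 (\<lambda>x. v2 x - u2 x) \<le> \<gamma> (\<lambda>x. v2 x - u2 x)"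
    using \<gamma>_pos \<gamma>(2) \<gamma>_ge diffs by blast+
  then have "0 \<le> - \<phi> 0 u1 - \<phi> 1 u2 + \<phi> 2 v1 + \<phi> 3 v2"
    using balance[OF A(4)] by (simp add: dualD(3)[OF D] dualD(3)[OF \<gamma>(1)] A)
  then show False
    using \<Phi>w A by (simp add: w_def \<Phi>_eq affine_uminus dualD(4)[OF D])
qed

text \<open>A first interpolant \<open>g\<close>, raised by \<epsilon>/4 to lie above both lower
  bounds, replaces \<open>v1\<close> and \<open>v2\<close> in a second interpolation against
  \<open>v3\<close>. The accumulated error is at most 3\<epsilon>/4.\<close>

lemma approximate_interpolation_2_3:
  assumes simplex: "choquet_simplex K" and A: "u1 \<in> A" "u2 \<in> A" "v1 \<in> A" "v2 \<in> A" "v3 \<in> A"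
    and le: "\<And>x u v. x \<in> K \<Longrightarrow> u \<in> {u1, u2} \<Longrightarrow> v \<in> {v1, v2, v3} \<Longrightarrow> u x \<le> v x"
    and \<epsilon>: "0 < \<epsilon>"
  shows "\<exists>h\<in>A. \<forall>x\<in>K. (\<forall>u\<in>{u1, u2}. u x - \<epsilon> \<le> h x) \<and> (\<forall>v\<in>{v1, v2, v3}. h x \<le> v x + \<epsilon>)"
proof -
  obtain g where g: "g \<in> A" "\<And>x. x \<in> K \<Longrightarrow> u1 x - \<epsilon> / 4 \<le> g x \<and> u2 x - \<epsilon> / 4 \<le> g x \<and>
      g x \<le> v1 x + \<epsilon> / 4 \<and> g x \<le> v2 x + \<epsilon> / 4"
    using approximate_interpolation[OF simplex A(1-4), of "\<epsilon> / 4"] le \<epsilon> by auto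
  have g': "(\<lambda>x. g x + \<epsilon> / 4 * indicator K x) \<in> A" by (intro affine_add affine_scale affine_one g)
  have "\<exists>h\<in>A. \<forall>x\<in>K. u1 x - \<epsilon> / 4 \<le> h x \<and> u2 x - \<epsilon> / 4 \<le> h x \<and>
      h x \<le> g x + \<epsilon> / 4 * indicator K x + \<epsilon> / 4 \<and> h x \<le> v3 x + \<epsilon> / 4"
  proof (rule approximate_interpolation[OF simplex A(1,2) g' A(5)])
    fix x assume x: "x \<in> K"
    then show "u1 x \<le> g x + \<epsilon> / 4 * indicator K x \<and> u1 x \<le> v3 x \<and>
        u2 x \<le> g x + \<epsilon> / 4 * indicator K x \<and> u2 x \<le> v3 x"
      using le[OF x] g(2)[OF x] by (auto simp: algebra_simps)
  qed (use \<epsilon> in simp)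
  then obtain h where h: "h \<in> A" "\<And>x. x \<in> K \<Longrightarrow> u1 x - \<epsilon> / 4 \<le> h x \<and> u2 x - \<epsilon> / 4 \<le> h x \<and>
      h x \<le> g x + \<epsilon> / 4 * indicator K x + \<epsilon> / 4 \<and> h x \<le> v3 x + \<epsilon> / 4" by blast
  show ?thesis
  proof (intro bexI[OF _ h(1)] ballI)
    fix x assume x: "x \<in> K"
    show "(\<forall>u\<in>{u1, u2}. u x - \<epsilon> \<le> h x) \<and> (\<forall>v\<in>{v1, v2, v3}. h x \<le> v x + \<epsilon>)"
      using h(2)[OF x] g(2)[OF x] x \<epsilon> by auto
  qed
qed

text \<open>The mirror image of the previous step: an interpolant lowered by \<epsilon>/4 replaces
  \<open>u1\<close> and \<open>u2\<close>, and \<open>u3\<close> is added as the second lower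
  bound.\<close>

lemma approximate_interpolation_3_3:
  assumes simplex: "choquet_simplex K"
    and A: "u1 \<in> A" "u2 \<in> A" "u3 \<in> A" "v1 \<in> A" "v2 \<in> A" "v3 \<in> A"
    and le: "\<And>x u v. x \<in> K \<Longrightarrow> u \<in> {u1, u2, u3} \<Longrightarrow> v \<in> {v1, v2, v3} \<Longrightarrow> u x \<le> v x"
    and \<epsilon>: "0 < \<epsilon>"
  shows "\<exists>h\<in>A. \<forall>x\<in>K. (\<forall>u\<in>{u1, u2, u3}. u x - \<epsilon> \<le> h x) \<and> (\<forall>v\<in>{v1, v2, v3}. h x \<le> v x + \<epsilon>)"
proof -
  have "\<exists>g\<in>A. \<forall>x\<in>K. (\<forall>u\<in>{u1, u2}. u x - \<epsilon> / 4 \<le> g x) \<and> (\<forall>v\<in>{v1, v2, v3}. g x \<le> v x + \<epsilon> / 4)"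
    by (rule approximate_interpolation_2_3[OF simplex A(1,2,4-6)]) (use le \<epsilon> in auto)
  then obtain g where g: "g \<in> A" "\<And>x. x \<in> K \<Longrightarrow>
      (\<forall>u\<in>{u1, u2}. u x - \<epsilon> / 4 \<le> g x) \<and> (\<forall>v\<in>{v1, v2, v3}. g x \<le> v x + \<epsilon> / 4)"
    by blast
  define g' where "g' = (\<lambda>x. g x - \<epsilon> / 4 * indicator K x)"
  have g': "g' \<in> A" unfolding g'_def by (intro affine_diff affine_scale affine_one g)
  have "\<exists>h\<in>A. \<forall>x\<in>K. (\<forall>u\<in>{g', u3}. u x - \<epsilon> / 4 \<le> h x) \<and> (\<forall>v\<in>{v1, v2, v3}. h x \<le> v x + \<epsilon> / 4)"
  proof (rule approximate_interpolation_2_3[OF simplex g' A(3-6)])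
    fix x u v assume x: "x \<in> K" and "u \<in> {g', u3}" and v: "v \<in> {v1, v2, v3}"
    then show "u x \<le> v x"
      using le[OF x _ v, of u3] g(2)[OF x] by (auto simp: g'_def algebra_simps)
  qed (use \<epsilon> in simp)
  then obtain h where h: "h \<in> A" "\<And>x. x \<in> K \<Longrightarrow>
      (\<forall>u\<in>{g', u3}. u x - \<epsilon> / 4 \<le> h x) \<and> (\<forall>v\<in>{v1, v2, v3}. h x \<le> v x + \<epsilon> / 4)" by blast
  show ?thesis
  proof (intro bexI[OF _ h(1)] ballI)
    fix x assume x: "x \<in> K"
    show "(\<forall>u\<in>{u1, u2, u3}. u x - \<epsilon> \<le> h x) \<and> (\<forall>v\<in>{v1, v2, v3}. h x \<le> v x + \<epsilon>)"
      using h(2)[OF x] g(2)[OF x] x \<epsilon> by (auto simp: g'_def)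
  qed
qed

text \<open>Approximate interpolants with errors \<open>(1 / 2) ^ n\<close> are chosen at summable
  successive distances, so they converge uniformly and the limit satisfies the bounds
  exactly.\<close>

lemma interpolation:
  assumes simplex: "choquet_simplex K" and A: "u1 \<in> A" "u2 \<in> A" "v1 \<in> A" "v2 \<in> A"
    and le: "\<And>x u v. x \<in> K \<Longrightarrow> u \<in> {u1, u2} \<Longrightarrow> v \<in> {v1, v2} \<Longrightarrow> u x \<le> v x"
  shows "\<exists>h\<in>A. \<forall>x\<in>K. (\<forall>u\<in>{u1, u2}. u x \<le> h x) \<and> (\<forall>v\<in>{v1, v2}. h x \<le> v x)"
proof -
  define P where "P n c \<longleftrightarrow> c \<in> A \<and> (\<forall>x\<in>K. (\<forall>u\<in>{u1, u2}. u x - (1 / 2) ^ n \<le> c x) \<and>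
    (\<forall>v\<in>{v1, v2}. c x \<le> v x + (1 / 2) ^ n))" for n :: nat and c
  define R where "R n c d \<longleftrightarrow> (\<forall>x\<in>K. \<bar>d x - c x\<bar> \<le> 2 * (1 / 2) ^ n)"
    for n :: nat and c d :: "'a \<Rightarrow> real"
  have "\<exists>c. \<forall>n. P n (c n) \<and> R n (c n) (c (Suc n))"
  proof (rule dependent_nat_choice)
    show "\<exists>c. P 0 c"
      using approximate_interpolation[OF simplex A, of 1] le by (auto simp: P_def)
  next
    fix c n assume c: "P n c"
    let ?\<delta> = "(1 / 2 :: real) ^ n"
    \<comment> \<open>The extra bounds \<open>l\<close> and \<open>r\<close> keep the next approximant close to \<open>c\<close>.\<close>
    define l where "l = (\<lambda>x. c x - ?\<delta> * indicator K x)"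
    define r where "r = (\<lambda>x. c x + ?\<delta> * indicator K x)"
    have lr: "l \<in> A" "r \<in> A"
      unfolding l_def r_def using c
      by (auto simp: P_def intro!: affine_add affine_diff affine_scale affine_one)
    have "\<exists>d\<in>A. \<forall>x\<in>K. (\<forall>u\<in>{u1, u2, l}. u x - ?\<delta> / 2 \<le> d x) \<and> (\<forall>v\<in>{v1, v2, r}. d x \<le> v x + ?\<delta> / 2)"
    proof (rule approximate_interpolation_3_3[OF simplex A(1,2) lr(1) A(3,4) lr(2)])
      fix x u v assume x: "x \<in> K" and uv: "u \<in> {u1, u2, l}" "v \<in> {v1, v2, r}"
      \<comment> \<open>That \<open>c\<close> interpolates up to \<delta> means precisely that
        \<open>l\<close> lies below the upper bounds and \<open>r\<close> above the lower
        ones.\<close>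
      have cx: "u1 x - ?\<delta> \<le> c x" "u2 x - ?\<delta> \<le> c x" "c x \<le> v1 x + ?\<delta>" "c x \<le> v2 x + ?\<delta>"
        using c x by (auto simp: P_def)
      have "l x = c x - ?\<delta>" "r x = c x + ?\<delta>" "0 < ?\<delta>" using x by (auto simp: l_def r_def)
      then show "u x \<le> v x" using uv cx le[OF x] by auto
    qed simp
    then obtain d where d: "d \<in> A" "\<And>x. x \<in> K \<Longrightarrow> (\<forall>u\<in>{u1, u2, l}. u x - ?\<delta> / 2 \<le> d x) \<and>
        (\<forall>v\<in>{v1, v2, r}. d x \<le> v x + ?\<delta> / 2)" by blast
    have "P (Suc n) d" using d by (auto simp: P_def)
    \<comment> \<open>The bounds \<open>l\<close> and \<open>r\<close> with error \<delta>/2 give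
      3\<delta>/2, which is rounded up to 2\<delta>.\<close>
    moreover have "\<bar>d x - c x\<bar> \<le> 2 * ?\<delta>" if x: "x \<in> K" for x
    proof -
      have "l x - ?\<delta> / 2 \<le> d x" "d x \<le> r x + ?\<delta> / 2" using d(2)[OF x] by auto
      moreover have "l x = c x - ?\<delta>" "r x = c x + ?\<delta>" "0 < ?\<delta>" using x by (auto simp: l_def r_def)
      ultimately show ?thesis by (simp only: abs_le_iff) linarith
    qed
    ultimately show "\<exists>d. P (Suc n) d \<and> R n c d" by (auto simp: R_def)
  qed
  then obtain c where cP: "\<And>n. P n (c n)" and cR: "\<And>n. R n (c n) (c (Suc n))" by blast
  have cA: "c n \<in> A" for n using cP by (simp add: P_def)
  \<comment> \<open>All \<open>c n\<close> vanish off \<open>K\<close>, so the estimate holds on the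
    whole space and the limit keeps the extension by zero.\<close>
  have step: "norm (c (Suc n) x - c n x) \<le> 2 * (1 / 2) ^ n" for n x
    using cR[of n] affineD(3)[OF cA, of x] by (cases "x \<in> K") (auto simp: R_def)
  have telescope: "(\<Sum>i<n. c (Suc i) x - c i x) = c n x - c 0 x" for n x
    by (rule sum_lessThan_telescope)
  define s where "s x = (\<Sum>i. c (Suc i) x - c i x)" for x
  have "uniform_limit UNIV (\<lambda>n x. \<Sum>i<n. c (Suc i) x - c i x) s sequentially"
    unfolding s_def using step by (rule Weierstrass_m_test) (intro summable_mult summable_geometric, simp)
  then have unif: "uniform_limit UNIV (\<lambda>n x. c n x - c 0 x) s sequentially"
    by (simp add: telescope)
  define h where "h = (\<lambda>x. s x + c 0 x)"
  have lim: "(\<lambda>n. c n x) \<longlonglongrightarrow> h x" for x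
    using tendsto_add[OF tendsto_uniform_limitI[OF unif, of x] tendsto_const[of "c 0 x"]]
    by (simp add: h_def)
  have "continuous_on K s"
  proof (rule uniform_limit_theorem)
    show "uniform_limit K (\<lambda>n x. c n x - c 0 x) s sequentially"
      using unif by (rule uniform_limit_on_subset) simp
    show "\<forall>\<^sub>F n in sequentially. continuous_on K (\<lambda>x. c n x - c 0 x)"
      by (intro always_eventually allI continuous_on_diff affineD cA)
  qed simp
  then have "continuous_on K h"
    unfolding h_def by (rule continuous_on_add[OF _ affineD(1)[OF cA]])
  then have hA: "h \<in> A"
  proof (rule affineI)
    fix x y t assume xyt: "x \<in> K" "y \<in> K" "t \<in> {0..1::real}"
    have "(\<lambda>n. (1 - t) * c n x + t * c n y) \<longlonglongrightarrow> (1 - t) * h x + t * h y"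
      by (intro tendsto_intros lim)
    then have "(\<lambda>n. c n ((1 - t) *\<^sub>R x + t *\<^sub>R y)) \<longlonglongrightarrow> (1 - t) * h x + t * h y"
      using affineD(2)[OF cA xyt] by simp
    then show "h ((1 - t) *\<^sub>R x + t *\<^sub>R y) = (1 - t) * h x + t * h y"
      using lim LIMSEQ_unique by blast
  next
    fix x assume "x \<notin> K"
    then show "h x = 0" using lim[of x] affineD(3)[OF cA] LIMSEQ_unique[OF _ tendsto_const] by simp
  qed
  have null: "(\<lambda>n. (1 / 2 :: real) ^ n) \<longlonglongrightarrow> 0" by (intro LIMSEQ_power_zero) simp
  have "u x \<le> h x" if "x \<in> K" "u \<in> {u1, u2}" for u x
  proof (rule LIMSEQ_le[OF _ lim])
    show "(\<lambda>n. u x - (1 / 2) ^ n) \<longlonglongrightarrow> u x" using tendsto_diff[OF tendsto_const null] by simp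
    show "\<exists>N. \<forall>n\<ge>N. u x - (1 / 2) ^ n \<le> c n x" using cP that by (auto simp: P_def)
  qed
  moreover have "h x \<le> v x" if "x \<in> K" "v \<in> {v1, v2}" for v x
  proof (rule LIMSEQ_le[OF lim])
    show "(\<lambda>n. v x + (1 / 2) ^ n) \<longlonglongrightarrow> v x" using tendsto_add[OF tendsto_const null] by simp
    show "\<exists>N. \<forall>n\<ge>N. c n x \<le> v x + (1 / 2) ^ n" using cP that by (auto simp: P_def)
  qed
  ultimately show ?thesis using hA by blast
qed

section \<open>Two-outcome measurements\<close>

text \<open>A 2 by 2 table with margins \<open>f\<close>, \<open>1 - f\<close> and \<open>g\<close>,
  \<open>1 - g\<close> is determined by its corner \<open>h\<close>; the other entries are
  \<open>f - h\<close>, \<open>g - h\<close> and \<open>1 - f - g + h\<close>, and the inequalities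
  state their positivity.\<close>

lemma two_outcome_compatible_iff:
  "(\<forall>f g. measurement K 2 f \<and> measurement K 2 g \<longrightarrow> compatible K 2 f 2 g) \<longleftrightarrow>
    (\<forall>f\<in>A_pos. \<forall>g\<in>A_pos. (\<forall>x\<in>K. f x \<le> 1 \<and> g x \<le> 1) \<longrightarrow>
      (\<exists>h\<in>A_pos. \<forall>x\<in>K. h x \<le> f x \<and> h x \<le> g x \<and> f x + g x - 1 \<le> h x))"
    (is "?L \<longleftrightarrow> ?R")
proof
  let ?u = "indicator K :: 'a \<Rightarrow> real"
  have two: "{1..2} = {1, 2::nat}" by auto
  show ?R if L: ?L
  proof (intro ballI impI)
    fix f g assume f: "f \<in> A_pos" and g: "g \<in> A_pos" and le: "\<forall>x\<in>K. f x \<le> 1 \<and> g x \<le> 1"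
    define M where "M f k = (if k = 1 then f else (\<lambda>x. ?u x - f x))" for f and k :: nat
    have "measurement K 2 (M f)" "measurement K 2 (M g)"
      unfolding measurement_def two
      using f g le by (auto simp: M_def posD intro!: pos_diff affine_one)
    with L have "compatible K 2 (M f) 2 (M g)" by blast
    then obtain h where h: "\<And>k j. k \<in> {1, 2} \<Longrightarrow> j \<in> {1, 2} \<Longrightarrow> h k j \<in> A_pos \<and>
        M f k = (\<lambda>x. h k 1 x + h k 2 x) \<and> M g j = (\<lambda>x. h 1 j x + h 2 j x)"
      unfolding compatible_def two by auto
    show "\<exists>h\<in>A_pos. \<forall>x\<in>K. h x \<le> f x \<and> h x \<le> g x \<and> f x + g x - 1 \<le> h x"
    proof (intro bexI ballI)
      show "h 1 1 \<in> A_pos" using h by blast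
      fix x assume x: "x \<in> K"
      have "M f 1 x = h 1 1 x + h 1 2 x" "M g 1 x = h 1 1 x + h 2 1 x" "M f 2 x = h 2 1 x + h 2 2 x"
        using h[of 1 1] h[of 2 2] by simp_all
      then have "f x = h 1 1 x + h 1 2 x" "g x = h 1 1 x + h 2 1 x" "1 - f x = h 2 1 x + h 2 2 x"
        using x by (simp_all add: M_def)
      moreover have "0 \<le> h 1 2 x" "0 \<le> h 2 1 x" "0 \<le> h 2 2 x"
        using h[of 1 2] h[of 2 1] h[of 2 2] x by (auto simp: posD)
      ultimately show "h 1 1 x \<le> f x \<and> h 1 1 x \<le> g x \<and> f x + g x - 1 \<le> h 1 1 x"
        by linarith
    qed
  qed
  show ?L if R: ?R
  proof (intro allI impI, elim conjE)
    fix f g assume "measurement K 2 f" "measurement K 2 g"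
    then have fg: "f 1 \<in> A_pos" "f 2 \<in> A_pos" "g 1 \<in> A_pos" "g 2 \<in> A_pos"
      and "(\<lambda>x. f 1 x + f 2 x) = ?u" "(\<lambda>x. g 1 x + g 2 x) = ?u"
      unfolding measurement_def two by auto
    then have f2: "f 2 = (\<lambda>x. ?u x - f 1 x)" and g2: "g 2 = (\<lambda>x. ?u x - g 1 x)"
      by (auto simp: fun_eq_iff algebra_simps)
    have le: "f 1 x \<le> 1 \<and> g 1 x \<le> 1" if "x \<in> K" for x
      using posD(2)[OF fg(2) that] posD(2)[OF fg(4) that] that by (simp add: f2 g2)
    have "\<exists>h\<in>A_pos. \<forall>x\<in>K. h x \<le> f 1 x \<and> h x \<le> g 1 x \<and> f 1 x + g 1 x - 1 \<le> h x"
      by (rule R[rule_format, OF fg(1,3) le])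
    then obtain h where h: "h \<in> A_pos"
      "\<And>x. x \<in> K \<Longrightarrow> h x \<le> f 1 x \<and> h x \<le> g 1 x \<and> f 1 x + g 1 x - 1 \<le> h x"
      by blast
    note mem = posD(1)[OF fg(1)] posD(1)[OF fg(3)] posD(1)[OF h(1)]
    define H where "H k j = (if k = 1 then if j = 1 then h else (\<lambda>x. f 1 x - h x)
      else if j = 1 then (\<lambda>x. g 1 x - h x) else (\<lambda>x. (?u x - f 1 x) - (g 1 x - h x)))" for k j :: nat
    have "(\<lambda>x. f 1 x - h x) \<in> A_pos" "(\<lambda>x. g 1 x - h x) \<in> A_pos"
      using h(2) by (intro pos_diff mem; blast)+
    moreover have "(\<lambda>x. (?u x - f 1 x) - (g 1 x - h x)) \<in> A_pos"
      using h(2) by (intro pos_diff affine_diff affine_one mem) (auto simp: algebra_simps)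
    ultimately have "H k j \<in> A_pos" for k j using h(1) by (simp add: H_def)
    moreover have "f k = (\<lambda>x. H k 1 x + H k 2 x)" if "k \<in> {1, 2}" for k
      using that f2 by (auto simp: H_def)
    moreover have "g j = (\<lambda>x. H 1 j x + H 2 j x)" if "j \<in> {1, 2}" for j
      using that g2 by (auto simp: H_def)
    ultimately show "compatible K 2 f 2 g"
      unfolding compatible_def two by (intro exI[of _ H]) simp
  qed
qed

end

theorem theorem1:
  fixes K :: "'a::locally_convex_t2_space set"
  assumes "compact K" and "convex K"
  shows "choquet_simplex K \<longleftrightarrow>
    (\<forall>f g. measurement K 2 f \<and> measurement K 2 g \<longrightarrow> compatible K 2 f 2 g)"
proof -
  interpret compact_convex K using assms by unfold_locales
  have "\<exists>h\<in>A_pos. \<forall>x\<in>K. h x \<le> f x \<and> h x \<le> g x \<and> f x + g x - 1 \<le> h x"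
    if simplex: "choquet_simplex K" and f: "f \<in> A_pos" and g: "g \<in> A_pos"
      and le: "\<forall>x\<in>K. f x \<le> 1 \<and> g x \<le> 1" for f g
  proof -
    \<comment> \<open>The indicator stands for the constant 1, so that \<open>f + g - 1\<close>
      vanishes off \<open>K\<close> as elements of \<open>A\<close> must. Interpolating between 0,
      \<open>?l\<close> and \<open>f\<close>, \<open>g\<close> gives the corner entry.\<close>
    let ?l = "\<lambda>x. f x + g x - indicator K x"
    have l: "?l \<in> A" using f g by (intro affine_diff affine_add affine_one posD)
    have "\<exists>h\<in>A. \<forall>x\<in>K. (\<forall>u\<in>{\<lambda>x. 0, ?l}. u x \<le> h x) \<and> (\<forall>v\<in>{f, g}. h x \<le> v x)"
      by (rule interpolation[OF simplex affine_zero l posD(1)[OF f] posD(1)[OF g]])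
        (use le f g in \<open>auto simp: posD\<close>)
    then show ?thesis by (auto simp: affine_functionals_pos_def)
  qed
  moreover have "choquet_simplex K"
    if "\<forall>f\<in>A_pos. \<forall>g\<in>A_pos. (\<forall>x\<in>K. f x \<le> 1 \<and> g x \<le> 1) \<longrightarrow>
      (\<exists>h\<in>A_pos. \<forall>x\<in>K. h x \<le> f x \<and> h x \<le> g x \<and> f x + g x - 1 \<le> h x)"
    using that by (intro choquet_simplexI positive_part_exists) blast
  ultimately show ?thesis unfolding two_outcome_compatible_iff by blast
qed

end
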